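(* Let $\mathcal E$ be an expanding edge replacement system and $\mathcal R_{\mathcal E}$ its associated VERS (any choice of partitions). Then the history graph of $\mathcal R_{\mathcal E}$ is Gromov hyperbolic, and its Gromov boundary (the limit space of $\mathcal R_{\mathcal E}$) is homeomorphic to the limit space $\Omega/\!\sim$ of $\mathcal E$.
   Context: Graphs have vertex set, edge set and maps $\iota,\tau$; loops and parallel edges allowed; adjacency and distances ignore orientation. Words read left to right; letters appended on the right. ERS $\mathcal E$: finite color set $C$, finite base graph $X_0$ with $C$-colored edges, for each $c\in C$ a finite graph $X_c$ with $C$-colored edges and distinguished vertices $\iota_c,\tau_c$. Expanding a $c$-colored edge $e$ replaces it by a copy of $X_c$, identifying $\iota_c$ with $\iota(e)$ and $\tau_c$ with $\tau(e)$. Full expansion sequence: $E_1=X_0$, $E_{n+1}$ obtained by expanding every edge of $E_n$; the edges of $E_n$ are the words $e_1\cdots e_n$ with $e_1\in E(X_0)$, $e_{i+1}\in E(X_{\mathrm{col}(e_i)})$. The symbol space $\Omega$ is the set of infinite words $e_1e_2\cdots$ all of whose prefixes $e_1\cdots e_n$ are edges of $E_n$, with the topology generated by cylinders (sets of elements with a given prefix). Gluing relation: $x_1x_2\cdots\sim y_1y_2\cdots$ iff for every $n$, $x_1\cdots x_n$ and $y_1\cdots y_n$ are equal or adjacent edges of $E_n$. $\mathcal E$ is expanding if (i) no base or replacement graph has an isolated vertex, (ii) each $X_c$ has a vertex other than $\iota_c,\tau_c$, (iii) no $X_c$ has an edge joining $\iota_c$ and $\tau_c$; then $\sim$ is an equivalence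 relation and the limit space of $\mathcal E$ is $\Omega/\!\sim$ with the quotient topology. Barycentric subdivision $\mathrm{bar}(Y)$ of a $C$-colored graph: vertices $V(Y)\sqcup E(Y)$; for each edge $e$ of color $c$, edges $\iota(e)\to e$ colored $c_\iota$ and $e\to\tau(e)$ colored $c_\tau$. VERS $\mathcal R_{\mathcal E}$: $\Sigma$ has vertices $C\sqcup\{\ast,s\}$ and edges: loop $V$ at $\ast$; $e\colon c\to c'$ for each edge $e$ of $X_c$ of color $c'$; $v\colon c\to\ast$ for $v\in V(X_c)\setminus\{\iota_c,\tau_c\}$; $e\colon s\to c$ for each edge $e$ of $X_0$ of color $c$; $v\colon s\to\ast$ for $v\in V(X_0)$ (labels distinct). Types of words = terminal vertex in $\Sigma$ of the path from $s$. Colors $\{c_0\}\sqcup C_\iota\sqcup C_\tau$. For each $c$ fix a partition of $\mathrm{bar}(X_c)$ into subgraphs $B_\iota,B_\tau$ (vertex sets covering, edge sets disjoint and covering) with $\tau_c\notin V(B_\iota)$, $\iota_c\notin V(B_\tau)$. $R_{c_\iota}$: edges of $B_\iota$ renamed by $\iota_c\mapsto\mathrm iV$, $z\mapsto\mathrm tz$ otherwise; $R_{c_\tau}$: edges of $B_\tau$ renamed by $\tau_c\mapsto\mathrm tV$, $z\mapsto\mathrm iz$ otherwise; $R_{c_0}$: for each edge $e$ of $X_0$ of color $c$, a $c_\iota$-edge $\mathrm i\,\iota(e)\to\mathrm te$ and a $c_\tau$-edge $\mathrm ie\to\mathrm t\,\tau(e)$. $\Gamma_0$: one $c_0$-colored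 loop at the empty word $\varepsilon$. Expansion of a typed graph $\Gamma$: vertices $ux$ ($u\in V(\Gamma)$, $x\in E(\Sigma)$, $\iota(x)=\mathrm{type}(u)$); for each edge of $\Gamma$ from $u$ to $v$ of color $c'$ and each edge of $R_{c'}$, an edge of the same color with $\mathrm i\mapsto u$, $\mathrm t\mapsto v$ in its endpoints. $\Gamma_{n+1}$ is the expansion of $\Gamma_n$. The history graph has vertex set all finite directed paths in $\Sigma$ from $s$, vertical edges $w\to wx$, and horizontal edges all edges of all $\Gamma_n$; it carries its graph metric. The Gromov boundary of a hyperbolic graph is the set of geodesic rays from a base vertex modulo bounded distance, with the visual topology. *)

theory Defs
  imports "HOL-Analysis.Analysis" "Graph_Theory.Digraph_Component"
begin

section \<open>Colored graphs\<close>

text \<open>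
  A directed multigraph (loops and parallel edges allowed) is a \<^typ>\<open>('v,'e) pre_digraph\<close>;
  \<^const>\<open>tail\<close> and \<^const>\<open>head\<close> are the maps $\iota$ and $\tau$.
\<close>

record ('v,'e,'c) cgraph =
  dig :: "('v,'e) pre_digraph"
  col :: "'e \<Rightarrow> 'c"

abbreviation cverts :: "('v,'e,'c) cgraph \<Rightarrow> 'v set" where "cverts G \<equiv> verts (dig G)"
abbreviation carcs :: "('v,'e,'c) cgraph \<Rightarrow> 'e set" where "carcs G \<equiv> arcs (dig G)"
abbreviation ctail :: "('v,'e,'c) cgraph \<Rightarrow> 'e \<Rightarrow> 'v" where "ctail G \<equiv> tail (dig G)"
abbreviation chead :: "('v,'e,'c) cgraph \<Rightarrow> 'e \<Rightarrow> 'v" where "chead G \<equiv> head (dig G)"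

section \<open>Edge replacement systems\<close>

text \<open>
  \<open>graph_of S None\<close> is the base graph and \<open>graph_of S (Some c)\<close> is the replacement graph of
  the color \<open>c\<close>.  These graphs are not required to be disjoint: whenever edges or vertices of
  several of them are put together, they are tagged by the index of the graph they come from.
\<close>

record ('c,'v,'e) ers =
  colors :: "'c set"
  graph_of :: "'c option \<Rightarrow> ('v,'e,'c) cgraph"
  iota_v :: "'c \<Rightarrow> 'v"
  tau_v :: "'c \<Rightarrow> 'v"

definition indices :: "('c,'v,'e) ers \<Rightarrow> 'c option set" where
  "indices S = insert None (Some ` colors S)"

text \<open>
  \<open>iota_v S c \<noteq> tau_v S c\<close> holds whenever a partition of the barycentric subdivision as in
  \<open>admissible_partition\<close> below exists.
\<close>

definition is_ers :: "('c,'v,'e) ers \<Rightarrow> bool" where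
  "is_ers S \<longleftrightarrow>
     finite (colors S) \<and>
     (\<forall>i\<in>indices S. fin_digraph (dig (graph_of S i)) \<and>
        col (graph_of S i) ` carcs (graph_of S i) \<subseteq> colors S) \<and>
     (\<forall>c\<in>colors S. iota_v S c \<in> cverts (graph_of S (Some c)) \<and>
        tau_v S c \<in> cverts (graph_of S (Some c)) \<and> iota_v S c \<noteq> tau_v S c)"

definition inner_verts :: "('c,'v,'e) ers \<Rightarrow> 'c \<Rightarrow> 'v set" where
  "inner_verts S c = cverts (graph_of S (Some c)) - {iota_v S c, tau_v S c}"

definition expanding :: "('c,'v,'e) ers \<Rightarrow> bool" where
  "expanding S \<longleftrightarrow>
     (\<forall>i\<in>indices S. \<forall>v\<in>cverts (graph_of S i). \<exists>e\<in>carcs (graph_of S i).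
        v = ctail (graph_of S i) e \<or> v = chead (graph_of S i) e) \<and>
     (\<forall>c\<in>colors S. inner_verts S c \<noteq> {}) \<and>
     (\<forall>c\<in>colors S. \<not> (\<exists>e\<in>carcs (graph_of S (Some c)).
        {ctail (graph_of S (Some c)) e, chead (graph_of S (Some c)) e} = {iota_v S c, tau_v S c}))"

subsection \<open>Full expansion sequence\<close>

text \<open>
  Edges of the expansions are words of tagged edges.  A vertex of an expansion is
  \<open>([], v)\<close> for a vertex \<open>v\<close> of the base graph, or \<open>(w, v)\<close> for an inner vertex \<open>v\<close> of the
  copy of the replacement graph that was substituted for the edge \<open>w\<close>.
  The map \<open>glue S Y w\<close> embeds the replacement graph of the color of \<open>w\<close> in the expansion of \<open>Y\<close>.
\<close>

type_synonym ('c,'e) eword = "('c option \<times> 'e) list"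
type_synonym ('c,'v,'e) egraph = "(('c,'e) eword \<times> 'v, ('c,'e) eword, 'c) cgraph"

definition base_expansion :: "('c,'v,'e) ers \<Rightarrow> ('c,'v,'e) egraph" where
  "base_expansion S = (let X = graph_of S None in
     \<lparr> dig = \<lparr> verts = (\<lambda>v. ([], v)) ` cverts X,
               arcs = (\<lambda>e. [(None, e)]) ` carcs X,
               tail = (\<lambda>w. ([], ctail X (snd (last w)))),
               head = (\<lambda>w. ([], chead X (snd (last w)))) \<rparr>,
       col = (\<lambda>w. col X (snd (last w))) \<rparr>)"

definition glue :: "('c,'v,'e) ers \<Rightarrow> ('c,'v,'e) egraph \<Rightarrow> ('c,'e) eword \<Rightarrow> 'v \<Rightarrow> ('c,'e) eword \<times> 'v" where
  "glue S Y w v =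
     (if v = iota_v S (col Y w) then ctail Y w
      else if v = tau_v S (col Y w) then chead Y w
      else (w, v))"

definition expand :: "('c,'v,'e) ers \<Rightarrow> ('c,'v,'e) egraph \<Rightarrow> ('c,'v,'e) egraph" where
  "expand S Y = (let X = (\<lambda>w. graph_of S (Some (col Y w))) in
     \<lparr> dig = \<lparr> verts = cverts Y \<union> {(w, v) |w v. w \<in> carcs Y \<and> v \<in> inner_verts S (col Y w)},
               arcs = {w @ [(Some (col Y w), e)] |w e. w \<in> carcs Y \<and> e \<in> carcs (X w)},
               tail = (\<lambda>u. glue S Y (butlast u) (ctail (X (butlast u)) (snd (last u)))),
               head = (\<lambda>u. glue S Y (butlast u) (chead (X (butlast u)) (snd (last u)))) \<rparr>,
       col = (\<lambda>u. col (X (butlast u)) (snd (last u))) \<rparr>)"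

text \<open>\<open>full_expansion S n\<close> is the graph $E_{n+1}$, whose edges are words of length $n+1$.\<close>

primrec full_expansion :: "('c,'v,'e) ers \<Rightarrow> nat \<Rightarrow> ('c,'v,'e) egraph" where
  "full_expansion S 0 = base_expansion S"
| "full_expansion S (Suc n) = expand S (full_expansion S n)"

definition adjacent_edges :: "('v,'e) pre_digraph \<Rightarrow> 'e \<Rightarrow> 'e \<Rightarrow> bool" where
  "adjacent_edges G e f \<longleftrightarrow> e \<in> arcs G \<and> f \<in> arcs G \<and> e \<noteq> f \<and>
     {tail G e, head G e} \<inter> {tail G f, head G f} \<noteq> {}"

subsection \<open>Limit space\<close>

abbreviation prefix_of :: "nat \<Rightarrow> (nat \<Rightarrow> 'a) \<Rightarrow> 'a list" where
  "prefix_of n x \<equiv> map x [0..<n]"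

definition symbol_space :: "('c,'v,'e) ers \<Rightarrow> (nat \<Rightarrow> 'c option \<times> 'e) set" where
  "symbol_space S = {x. \<forall>n. prefix_of (Suc n) x \<in> carcs (full_expansion S n)}"

definition symbol_topology :: "('c,'v,'e) ers \<Rightarrow> (nat \<Rightarrow> 'c option \<times> 'e) topology" where
  "symbol_topology S =
     topology_generated_by {{x \<in> symbol_space S. prefix_of (length w) x = w} |w. True}"

definition gluing :: "('c,'v,'e) ers \<Rightarrow> (nat \<Rightarrow> 'c option \<times> 'e) rel" where
  "gluing S = {(x, y). x \<in> symbol_space S \<and> y \<in> symbol_space S \<and>
     (\<forall>n. prefix_of (Suc n) x = prefix_of (Suc n) y \<or>
        adjacent_edges (dig (full_expansion S n)) (prefix_of (Suc n) x) (prefix_of (Suc n) y))}"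

definition quotient_topology :: "'a topology \<Rightarrow> 'a rel \<Rightarrow> 'a set topology" where
  "quotient_topology X R =
     topology (\<lambda>U. U \<subseteq> topspace X // R \<and> openin X {x \<in> topspace X. R `` {x} \<in> U})"

lemma istopology_quotient:
  "istopology (\<lambda>U. U \<subseteq> topspace X // R \<and> openin X {x \<in> topspace X. R `` {x} \<in> U})"
  unfolding istopology_def
proof (intro conjI allI impI)
  fix U V
  assume U: "U \<subseteq> topspace X // R \<and> openin X {x \<in> topspace X. R `` {x} \<in> U}"
     and V: "V \<subseteq> topspace X // R \<and> openin X {x \<in> topspace X. R `` {x} \<in> V}"
  show "U \<inter> V \<subseteq> topspace X // R" using U by (intro le_infI1) simp
  have eq: "{x \<in> topspace X. R `` {x} \<in> U \<inter> V} =
        {x \<in> topspace X. R `` {x} \<in> U} \<inter> {x \<in> topspace X. R `` {x} \<in> V}" by auto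
  show "openin X {x \<in> topspace X. R `` {x} \<in> U \<inter> V}"
    unfolding eq using U V by (intro openin_Int) simp_all
next
  fix K
  assume K: "\<forall>U\<in>K. U \<subseteq> topspace X // R \<and> openin X {x \<in> topspace X. R `` {x} \<in> U}"
  show "\<Union>K \<subseteq> topspace X // R" using K by (intro Sup_least) simp
  have eq: "{x \<in> topspace X. R `` {x} \<in> \<Union>K} = (\<Union>U\<in>K. {x \<in> topspace X. R `` {x} \<in> U})" by auto
  show "openin X {x \<in> topspace X. R `` {x} \<in> \<Union>K}"
    unfolding eq using K by (intro openin_Union) blast
qed

lemma openin_quotient_topology:
  "openin (quotient_topology X R) U \<longleftrightarrow>
     U \<subseteq> topspace X // R \<and> openin X {x \<in> topspace X. R `` {x} \<in> U}"
  unfolding quotient_topology_def topology_inverse'[OF istopology_quotient] ..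

lemma topspace_quotient_topology: "topspace (quotient_topology X R) = topspace X // R"
proof -
  have "{x \<in> topspace X. R `` {x} \<in> topspace X // R} = topspace X" by (auto simp: quotientI)
  then have "openin (quotient_topology X R) (topspace X // R)"
    by (simp add: openin_quotient_topology)
  then have "topspace X // R \<subseteq> topspace (quotient_topology X R)" by (rule openin_subset)
  moreover have "openin (quotient_topology X R) (topspace (quotient_topology X R))"
    by (rule openin_topspace)
  ultimately show ?thesis unfolding openin_quotient_topology by (simp add: subset_antisym)
qed

lemma quotient_map_quotient_topology:
  "quotient_map X (quotient_topology X R) (\<lambda>x. R `` {x})"
proof -
  have "(\<lambda>x. R `` {x}) ` topspace X = topspace X // R" unfolding quotient_def by blast
  then show ?thesis
    unfolding quotient_map_def by (simp add: openin_quotient_topology topspace_quotient_topology)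
qed

definition limit_space :: "('c,'v,'e) ers \<Rightarrow> (nat \<Rightarrow> 'c option \<times> 'e) set topology" where
  "limit_space S = quotient_topology (symbol_topology S) (gluing S)"

lemma topspace_symbol_topology: "topspace (symbol_topology S) = symbol_space S"
proof -
  have "symbol_space S = {x \<in> symbol_space S. prefix_of (length []) x = []}" by simp
  then have "symbol_space S \<in> {{x \<in> symbol_space S. prefix_of (length w) x = w} |w. True}" by blast
  then show ?thesis unfolding symbol_topology_def topology_generated_by_topspace by blast
qed

section \<open>Barycentric subdivision\<close>

datatype 'e half = IHalf 'e | THalf 'e

datatype 'c vcolor = C0 | CI 'c | CT 'c

definition bar :: "('v,'e,'c) cgraph \<Rightarrow> ('v + 'e, 'e half, 'c vcolor) cgraph" where
  "bar Y =
     \<lparr> dig = \<lparr> verts = cverts Y <+> carcs Y,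
               arcs = IHalf ` carcs Y \<union> THalf ` carcs Y,
               tail = (\<lambda>h. case h of IHalf e \<Rightarrow> Inl (ctail Y e) | THalf e \<Rightarrow> Inr e),
               head = (\<lambda>h. case h of IHalf e \<Rightarrow> Inr e | THalf e \<Rightarrow> Inl (chead Y e)) \<rparr>,
       col = (\<lambda>h. case h of IHalf e \<Rightarrow> CI (col Y e) | THalf e \<Rightarrow> CT (col Y e)) \<rparr>"

text \<open>The families \<open>BI\<close> and \<open>BT\<close> consist of the subgraphs $B_\iota$ and $B_\tau$ for each color.\<close>

definition admissible_partition ::
  "('c,'v,'e) ers \<Rightarrow> ('c \<Rightarrow> ('v + 'e, 'e half) pre_digraph) \<Rightarrow>
   ('c \<Rightarrow> ('v + 'e, 'e half) pre_digraph) \<Rightarrow> bool" where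
  "admissible_partition S BI BT \<longleftrightarrow> (\<forall>c\<in>colors S.
     let X = dig (bar (graph_of S (Some c))) in
       subgraph (BI c) X \<and> subgraph (BT c) X \<and>
       verts (BI c) \<union> verts (BT c) = verts X \<and>
       arcs (BI c) \<inter> arcs (BT c) = {} \<and> arcs (BI c) \<union> arcs (BT c) = arcs X \<and>
       Inl (tau_v S c) \<notin> verts (BI c) \<and> Inl (iota_v S c) \<notin> verts (BT c))"

section \<open>Vertex and edge replacement systems\<close>

text \<open>
  A VERS consists of the type graph $\Sigma$, its vertex $s$, the replacement graphs $R_{c'}$, and
  the color of the loop of the base graph.  The vertices $\mathrm{i}x$ and $\mathrm{t}x$ of the
  replacement graphs are \<open>(Ini, x)\<close> and \<open>(Ter, x)\<close>.
\<close>

datatype side = Ini | Ter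

record ('q,'l,'r,'k) vers =
  type_graph :: "('q,'l) pre_digraph"
  start :: 'q
  vrepl :: "'k \<Rightarrow> (side \<times> 'l, 'r, 'k) cgraph"
  start_color :: 'k

definition word_type :: "('q,'l,'r,'k) vers \<Rightarrow> 'l list \<Rightarrow> 'q" where
  "word_type V w = pre_digraph.awlast (type_graph V) (start V) w"

definition base_level :: "('q,'l,'r,'k) vers \<Rightarrow> ('l list, 'r list, 'k) cgraph" where
  "base_level V =
     \<lparr> dig = \<lparr> verts = {[]}, arcs = {[]}, tail = (\<lambda>_. []), head = (\<lambda>_. []) \<rparr>,
       col = (\<lambda>_. start_color V) \<rparr>"

text \<open>
  An edge of a level is a list: appending an edge of the replacement graph of the color of \<open>a\<close>
  to \<open>a\<close> gives an edge of the next level.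
\<close>

definition place :: "('l list, 'r list, 'k) cgraph \<Rightarrow> 'r list \<Rightarrow> side \<times> 'l \<Rightarrow> 'l list" where
  "place G a p = (case p of (Ini, x) \<Rightarrow> ctail G a @ [x] | (Ter, x) \<Rightarrow> chead G a @ [x])"

definition next_level ::
  "('q,'l,'r,'k) vers \<Rightarrow> ('l list, 'r list, 'k) cgraph \<Rightarrow> ('l list, 'r list, 'k) cgraph" where
  "next_level V G = (let R = (\<lambda>a. vrepl V (col G a)) in
     \<lparr> dig = \<lparr> verts = {u @ [x] |u x. u \<in> cverts G \<and> x \<in> arcs (type_graph V) \<and>
                          tail (type_graph V) x = word_type V u},
               arcs = {a @ [r] |a r. a \<in> carcs G \<and> r \<in> carcs (R a)},
               tail = (\<lambda>b. place G (butlast b) (ctail (R (butlast b)) (last b))),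
               head = (\<lambda>b. place G (butlast b) (chead (R (butlast b)) (last b))) \<rparr>,
       col = (\<lambda>b. col (R (butlast b)) (last b)) \<rparr>)"

primrec level :: "('q,'l,'r,'k) vers \<Rightarrow> nat \<Rightarrow> ('l list, 'r list, 'k) cgraph" where
  "level V 0 = base_level V"
| "level V (Suc n) = next_level V (level V n)"

datatype ('l,'r) hist_edge = Vertical "'l list" 'l | Horizontal nat "'r list"

definition start_paths :: "('q,'l,'r,'k) vers \<Rightarrow> 'l list set" where
  "start_paths V = {w. \<exists>q. pre_digraph.awalk (type_graph V) (start V) w q}"

definition history_graph :: "('q,'l,'r,'k) vers \<Rightarrow> ('l list, ('l,'r) hist_edge) pre_digraph" where
  "history_graph V =
     \<lparr> verts = start_paths V,
       arcs = {Vertical w x |w x. w \<in> start_paths V \<and> w @ [x] \<in> start_paths V} \<union>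
              {Horizontal n a |n a. a \<in> carcs (level V n)},
       tail = (\<lambda>h. case h of Vertical w x \<Rightarrow> w | Horizontal n a \<Rightarrow> ctail (level V n) a),
       head = (\<lambda>h. case h of Vertical w x \<Rightarrow> w @ [x] | Horizontal n a \<Rightarrow> chead (level V n) a) \<rparr>"

subsection \<open>The VERS associated with an edge replacement system\<close>

datatype 'c snode = Star | Source | Col 'c

text \<open>
  Letters, i.e. edges of $\Sigma$, carry the index of the base or replacement graph they come
  from, which makes all labels distinct.
\<close>

datatype ('c,'v,'e) letter = LoopV | EdgeL "'c option" 'e | VertL "'c option" 'v

definition node_of :: "'c option \<Rightarrow> 'c snode" where
  "node_of i = (case i of None \<Rightarrow> Source | Some c \<Rightarrow> Col c)"

definition ers_type_graph :: "('c,'v,'e) ers \<Rightarrow> ('c snode, ('c,'v,'e) letter) pre_digraph" where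
  "ers_type_graph S =
     \<lparr> verts = {Star, Source} \<union> Col ` colors S,
       arcs = {LoopV} \<union>
              {EdgeL i e |i e. i \<in> indices S \<and> e \<in> carcs (graph_of S i)} \<union>
              {VertL None v |v. v \<in> cverts (graph_of S None)} \<union>
              {VertL (Some c) v |c v. c \<in> colors S \<and> v \<in> inner_verts S c},
       tail = (\<lambda>x. case x of LoopV \<Rightarrow> Star | EdgeL i e \<Rightarrow> node_of i | VertL i v \<Rightarrow> node_of i),
       head = (\<lambda>x. case x of LoopV \<Rightarrow> Star | EdgeL i e \<Rightarrow> Col (col (graph_of S i) e) | VertL i v \<Rightarrow> Star) \<rparr>"

definition bar_letter :: "'c option \<Rightarrow> 'v + 'e \<Rightarrow> ('c,'v,'e) letter" where
  "bar_letter i z = (case z of Inl v \<Rightarrow> VertL i v | Inr e \<Rightarrow> EdgeL i e)"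

definition ren_iota :: "('c,'v,'e) ers \<Rightarrow> 'c \<Rightarrow> 'v + 'e \<Rightarrow> side \<times> ('c,'v,'e) letter" where
  "ren_iota S c z = (if z = Inl (iota_v S c) then (Ini, LoopV) else (Ter, bar_letter (Some c) z))"

definition ren_tau :: "('c,'v,'e) ers \<Rightarrow> 'c \<Rightarrow> 'v + 'e \<Rightarrow> side \<times> ('c,'v,'e) letter" where
  "ren_tau S c z = (if z = Inl (tau_v S c) then (Ter, LoopV) else (Ini, bar_letter (Some c) z))"

text \<open>
  The replacement graph of \<open>C0\<close> has the same edges as the barycentric subdivision of the base
  graph; an edge from \<open>z\<close> to \<open>z'\<close> there becomes an edge from $\mathrm{i}z$ to $\mathrm{t}z'$.
\<close>

definition ers_vrepl ::
  "('c,'v,'e) ers \<Rightarrow> ('c \<Rightarrow> ('v + 'e, 'e half) pre_digraph) \<Rightarrow>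
   ('c \<Rightarrow> ('v + 'e, 'e half) pre_digraph) \<Rightarrow> 'c vcolor \<Rightarrow>
   (side \<times> ('c,'v,'e) letter, 'e half, 'c vcolor) cgraph" where
  "ers_vrepl S BI BT k = (case k of
     C0 \<Rightarrow> let X = bar (graph_of S None) in
       \<lparr> dig = \<lparr> verts = {Ini, Ter} \<times> bar_letter None ` cverts X,
                 arcs = carcs X,
                 tail = (\<lambda>h. (Ini, bar_letter None (ctail X h))),
                 head = (\<lambda>h. (Ter, bar_letter None (chead X h))) \<rparr>,
         col = col X \<rparr>
   | CI c \<Rightarrow>
       \<lparr> dig = \<lparr> verts = ren_iota S c ` verts (BI c),
                 arcs = arcs (BI c),
                 tail = (\<lambda>h. ren_iota S c (tail (BI c) h)),
                 head = (\<lambda>h. ren_iota S c (head (BI c) h)) \<rparr>,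
         col = col (bar (graph_of S (Some c))) \<rparr>
   | CT c \<Rightarrow>
       \<lparr> dig = \<lparr> verts = ren_tau S c ` verts (BT c),
                 arcs = arcs (BT c),
                 tail = (\<lambda>h. ren_tau S c (tail (BT c) h)),
                 head = (\<lambda>h. ren_tau S c (head (BT c) h)) \<rparr>,
         col = col (bar (graph_of S (Some c))) \<rparr>)"

definition vers_of ::
  "('c,'v,'e) ers \<Rightarrow> ('c \<Rightarrow> ('v + 'e, 'e half) pre_digraph) \<Rightarrow>
   ('c \<Rightarrow> ('v + 'e, 'e half) pre_digraph) \<Rightarrow>
   ('c snode, ('c,'v,'e) letter, 'e half, 'c vcolor) vers" where
  "vers_of S BI BT =
     \<lparr> type_graph = ers_type_graph S, start = Source, vrepl = ers_vrepl S BI BT, start_color = C0 \<rparr>"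

section \<open>Hyperbolic graphs and their boundary\<close>

text \<open>
  Distances ignore orientation.  The graph metric is considered on the vertex set; this
  is the geometric realization up to distance 1/2.
\<close>

definition neighbours :: "('v,'e) pre_digraph \<Rightarrow> 'v rel" where
  "neighbours G = arcs_ends G \<union> (arcs_ends G)\<inverse>"

definition connected_graph :: "('v,'e) pre_digraph \<Rightarrow> bool" where
  "connected_graph G \<longleftrightarrow> (\<forall>x\<in>verts G. \<forall>y\<in>verts G. \<exists>n. (x, y) \<in> neighbours G ^^ n)"

definition graph_dist :: "('v,'e) pre_digraph \<Rightarrow> 'v \<Rightarrow> 'v \<Rightarrow> nat" where
  "graph_dist G x y = (LEAST n. (x, y) \<in> neighbours G ^^ n)"

definition gromov_product :: "('v,'e) pre_digraph \<Rightarrow> 'v \<Rightarrow> 'v \<Rightarrow> 'v \<Rightarrow> real" where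
  "gromov_product G p x y =
     (real (graph_dist G p x) + real (graph_dist G p y) - real (graph_dist G x y)) / 2"

definition gromov_hyperbolic :: "('v,'e) pre_digraph \<Rightarrow> bool" where
  "gromov_hyperbolic G \<longleftrightarrow> connected_graph G \<and>
     (\<exists>\<delta>\<ge>0. \<forall>p\<in>verts G. \<forall>x\<in>verts G. \<forall>y\<in>verts G. \<forall>z\<in>verts G.
        gromov_product G p x z \<ge> min (gromov_product G p x y) (gromov_product G p y z) - \<delta>)"

definition geodesic_rays :: "('v,'e) pre_digraph \<Rightarrow> 'v \<Rightarrow> (nat \<Rightarrow> 'v) set" where
  "geodesic_rays G p = {\<gamma>. \<gamma> 0 = p \<and> range \<gamma> \<subseteq> verts G \<and>
     (\<forall>m n. m \<le> n \<longrightarrow> graph_dist G (\<gamma> m) (\<gamma> n) = n - m)}"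

definition asymptotic :: "('v,'e) pre_digraph \<Rightarrow> 'v \<Rightarrow> (nat \<Rightarrow> 'v) rel" where
  "asymptotic G p = {(\<gamma>, \<gamma>'). \<gamma> \<in> geodesic_rays G p \<and> \<gamma>' \<in> geodesic_rays G p \<and>
     (\<exists>K. \<forall>n. graph_dist G (\<gamma> n) (\<gamma>' n) \<le> K)}"

definition boundary_points :: "('v,'e) pre_digraph \<Rightarrow> 'v \<Rightarrow> (nat \<Rightarrow> 'v) set set" where
  "boundary_points G p = geodesic_rays G p // asymptotic G p"

text \<open>
  The visual topology: the sets \<open>visual_nbhd G p \<xi> r\<close> form a neighbourhood basis at \<open>\<xi>\<close>.
\<close>

definition visual_nbhd :: "('v,'e) pre_digraph \<Rightarrow> 'v \<Rightarrow> (nat \<Rightarrow> 'v) set \<Rightarrow> real \<Rightarrow> (nat \<Rightarrow> 'v) set set" where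
  "visual_nbhd G p \<xi> r = {\<eta> \<in> boundary_points G p. \<exists>\<gamma>\<in>\<xi>. \<exists>\<gamma>'\<in>\<eta>.
     liminf (\<lambda>n. ereal (gromov_product G p (\<gamma> n) (\<gamma>' n))) \<ge> ereal r}"

definition visual_open :: "('v,'e) pre_digraph \<Rightarrow> 'v \<Rightarrow> (nat \<Rightarrow> 'v) set set \<Rightarrow> bool" where
  "visual_open G p U \<longleftrightarrow> U \<subseteq> boundary_points G p \<and> (\<forall>\<xi>\<in>U. \<exists>r. visual_nbhd G p \<xi> r \<subseteq> U)"

definition gromov_boundary :: "('v,'e) pre_digraph \<Rightarrow> 'v \<Rightarrow> (nat \<Rightarrow> 'v) set topology" where
  "gromov_boundary G p = topology (visual_open G p)"

lemma visual_nbhd_antimono: "r \<le> s \<Longrightarrow> visual_nbhd G p \<xi> s \<subseteq> visual_nbhd G p \<xi> r"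
proof
  fix \<eta>
  assume rs: "r \<le> s" and "\<eta> \<in> visual_nbhd G p \<xi> s"
  then obtain \<gamma> \<gamma>' where *: "\<eta> \<in> boundary_points G p" "\<gamma> \<in> \<xi>" "\<gamma>' \<in> \<eta>"
    "ereal s \<le> liminf (\<lambda>n. ereal (gromov_product G p (\<gamma> n) (\<gamma>' n)))"
    unfolding visual_nbhd_def by blast
  have "ereal r \<le> ereal s" using rs by simp
  from this *(4) have "ereal r \<le> liminf (\<lambda>n. ereal (gromov_product G p (\<gamma> n) (\<gamma>' n)))"
    by (rule order_trans)
  then show "\<eta> \<in> visual_nbhd G p \<xi> r" unfolding visual_nbhd_def using * by blast
qed

lemma istopology_visual_open: "istopology (visual_open G p)"
  unfolding istopology_def
proof (intro conjI allI impI)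
  fix U V
  assume U: "visual_open G p U" and V: "visual_open G p V"
  show "visual_open G p (U \<inter> V)"
    unfolding visual_open_def
  proof (intro conjI ballI)
    show "U \<inter> V \<subseteq> boundary_points G p"
      using U unfolding visual_open_def by (intro le_infI1) simp
  next
    fix \<xi> assume \<xi>: "\<xi> \<in> U \<inter> V"
    obtain r where r: "visual_nbhd G p \<xi> r \<subseteq> U" using U \<xi> unfolding visual_open_def by force
    obtain s where s: "visual_nbhd G p \<xi> s \<subseteq> V" using V \<xi> unfolding visual_open_def by force
    have "visual_nbhd G p \<xi> (max r s) \<subseteq> U \<inter> V"
    proof (rule Int_greatest)
      show "visual_nbhd G p \<xi> (max r s) \<subseteq> U"
        using visual_nbhd_antimono[of r "max r s" G p \<xi>] r by simp
      show "visual_nbhd G p \<xi> (max r s) \<subseteq> V"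
        using visual_nbhd_antimono[of s "max r s" G p \<xi>] s by simp
    qed
    then show "\<exists>t. visual_nbhd G p \<xi> t \<subseteq> U \<inter> V" ..
  qed
next
  fix K
  assume K: "\<forall>U\<in>K. visual_open G p U"
  show "visual_open G p (\<Union>K)"
    unfolding visual_open_def
  proof (intro conjI ballI)
    show "\<Union>K \<subseteq> boundary_points G p"
      using K unfolding visual_open_def by (intro Sup_least) simp
  next
    fix \<xi> assume "\<xi> \<in> \<Union>K"
    then obtain U where U: "U \<in> K" "\<xi> \<in> U" by blast
    have "visual_open G p U" using K U(1) by simp
    then obtain r where "visual_nbhd G p \<xi> r \<subseteq> U" using U(2) unfolding visual_open_def by force
    then show "\<exists>r. visual_nbhd G p \<xi> r \<subseteq> \<Union>K" using U(1) by (intro exI[of _ r]) (rule order_trans, assumption, rule Sup_upper)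
  qed
qed

lemma openin_gromov_boundary: "openin (gromov_boundary G p) U \<longleftrightarrow> visual_open G p U"
  unfolding gromov_boundary_def topology_inverse'[OF istopology_visual_open] ..

lemma topspace_gromov_boundary: "topspace (gromov_boundary G p) = boundary_points G p"
proof -
  have "visual_open G p (boundary_points G p)"
    unfolding visual_open_def visual_nbhd_def by blast
  then have "boundary_points G p \<subseteq> topspace (gromov_boundary G p)"
    by (simp add: openin_subset openin_gromov_boundary)
  moreover have "openin (gromov_boundary G p) (topspace (gromov_boundary G p))"
    by (rule openin_topspace)
  ultimately show ?thesis
    unfolding openin_gromov_boundary visual_open_def by (simp add: subset_antisym)
qed

end

theory Submission
  imports Defs
begin

text \<open>
  Level \<open>n + 1\<close> of the history graph is the barycentric subdivision of \<open>full_expansion S n\<close>, and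
  horizontal neighbours have equal or horizontally adjacent parents, so the history graph is an
  augmented tree.  Since no replacement graph has an edge between its two distinguished vertices,
  three horizontal steps become at most two when one passes to the parents.  Calling two words near at level
  \<open>k\<close> if their prefixes of length \<open>k\<close> have horizontal distance at most 2, the distance of two words is therefore,
  up to a constant, the sum of their lengths minus twice the largest level at which they are near,
  and nearness at a level is transitive up to a loss of two levels.  This gives hyperbolicity.

  An infinite word in the symbol space is a vertical ray, each of which is asymptotic to a geodesic
  ray.  As every vertex has an incident edge, Koenig's lemma applied to edges close to a geodesic
  ray gives the converse.  Two vertical rays have bounded distance iff their
  prefixes have horizontal distance at most 2 for all lengths, which is the gluing relation, and a second
  application of Koenig's lemma compares the visual topology with the cylinder topology.
\<close>

section \<open>The metric of a connected graph\<close>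

text \<open>A tree with edges added inside its levels is hyperbolic only if these edges contract
  fast enough towards the root. Ascending by one level lengthens a path by two vertical edges, so a
  long horizontal stretch has to lose two edges per level for the bookkeeping to close up with a
  bounded error; contracting two disjoint pieces of three edges does this. The number 2 in the
  definition of nearness is the distance, in a barycentric subdivision, of two edges that share an
  end. On edge words nearness is therefore exactly "equal or adjacent", which is why it meets the
  gluing relation without further loss. The obstacle on the boundary side is that vertical rays need
  not come from the symbol space: the word of a vertex followed by letters \<open>LoopV\<close>
  forever is one as well, and geodesic rays may move horizontally. The boundary is therefore coded
  by edge words alone, and the other vertices only have to lie within one horizontal step of a coded
  word. The homeomorphism arises from a quotient map of the symbol space onto the boundary whose
  fibres are the gluing classes.\<close>

lemma relpow_reflcl_mono: "m \<le> n \<Longrightarrow> (R\<^sup>=) ^^ m \<subseteq> (R\<^sup>=) ^^ n"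
proof (induction n)
  case (Suc n)
  have "(R\<^sup>=) ^^ n \<subseteq> (R\<^sup>=) ^^ Suc n"
    by auto
  with Suc show ?case by (cases "m = Suc n") auto
qed simp

lemma relpow_sym:
  assumes "sym R" "(x, y) \<in> R ^^ n"
  shows "(y, x) \<in> R ^^ n"
  using assms(2)
proof (induction n arbitrary: y)
  case (Suc n)
  then obtain z where "(x, z) \<in> R ^^ n" "(z, y) \<in> R" by auto
  with Suc.IH assms(1) show ?case by (meson relpow_Suc_I2 symD)
qed simp

lemma sym_neighbours: "sym (neighbours G)"
  unfolding neighbours_def by (auto simp: sym_def)

locale connected_digraph = wf_digraph +
  assumes connected: "connected_graph G"
begin

abbreviation d where "d \<equiv> graph_dist G"

lemma neighbours_verts: "(x, y) \<in> neighbours G \<Longrightarrow> x \<in> verts G \<and> y \<in> verts G"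
  unfolding neighbours_def arcs_ends_conv by auto

lemma dist_path:
  assumes "x \<in> verts G" "y \<in> verts G"
  shows "(x, y) \<in> neighbours G ^^ d x y"
  using assms connected unfolding connected_graph_def graph_dist_def by (meson LeastI)

lemma dist_le: "(x, y) \<in> neighbours G ^^ n \<Longrightarrow> d x y \<le> n"
  unfolding graph_dist_def by (rule Least_le)

lemma dist_refl [simp]: "d x x = 0"
  using dist_le[of x x 0] by simp

lemma dist_sym: "d x y = d y x"
proof -
  have "(x, y) \<in> neighbours G ^^ n \<longleftrightarrow> (y, x) \<in> neighbours G ^^ n" for n
    using relpow_sym[OF sym_neighbours, of x y n G] relpow_sym[OF sym_neighbours, of y x n G] by blast
  then show ?thesis unfolding graph_dist_def by simp
qed

lemma dist_triangle:
  assumes "x \<in> verts G" "y \<in> verts G" "z \<in> verts G"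
  shows "d x z \<le> d x y + d y z"
  using dist_path[OF assms(1,2)] dist_path[OF assms(2,3)]
  by (intro dist_le) (auto simp: relpow_add)

lemma dist_neighbour: "(x, y) \<in> neighbours G \<Longrightarrow> d x y \<le> 1"
  by (rule dist_le) simp

text \<open>Steps of size at most 1 bound every \<open>d (\<gamma> m) (\<gamma> n)\<close> from
  above, and one later point at full distance from \<open>p\<close> forces equality, since a
  shortcut would bring that point closer. It is therefore enough to control the distance to
  \<open>p\<close> from some \<open>M\<close> on.\<close>

lemma geodesic_rayI:
  assumes ray: "\<gamma> 0 = p" "range \<gamma> \<subseteq> verts G" and step: "\<And>n. d (\<gamma> n) (\<gamma> (Suc n)) \<le> 1"
    and far: "\<And>n. n \<ge> M \<Longrightarrow> d p (\<gamma> n) = n"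
  shows "\<gamma> \<in> geodesic_rays G p"
proof -
  have V: "\<gamma> n \<in> verts G" for n using ray by auto
  have le: "d (\<gamma> m) (\<gamma> (m + k)) \<le> k" for m k
  proof (induction k)
    case (Suc k)
    have "d (\<gamma> m) (\<gamma> (m + Suc k)) \<le> d (\<gamma> m) (\<gamma> (m + k)) + d (\<gamma> (m + k)) (\<gamma> (m + Suc k))"
      by (rule dist_triangle) (use V in auto)
    with Suc step[of "m + k"] show ?case by simp
  qed simp
  have "d (\<gamma> m) (\<gamma> n) = n - m" if "m \<le> n" for m n
  proof -
    let ?N = "n + M"
    have "?N = d (\<gamma> 0) (\<gamma> ?N)" using far[of ?N] ray(1) by simp
    also have "\<dots> \<le> d (\<gamma> 0) (\<gamma> m) + (d (\<gamma> m) (\<gamma> n) + d (\<gamma> n) (\<gamma> ?N))"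
      by (meson V dist_triangle add_left_mono order_trans)
    also have "\<dots> \<le> m + d (\<gamma> m) (\<gamma> n) + M"
      using le[of 0 m] le[of n M] by simp
    finally show ?thesis using le[of m "n - m"] that by simp
  qed
  with ray show ?thesis unfolding geodesic_rays_def by simp
qed

lemma geodesic_rayD:
  assumes "\<gamma> \<in> geodesic_rays G p"
  shows "\<gamma> n \<in> verts G" "d p (\<gamma> n) = n" "m \<le> n \<Longrightarrow> d (\<gamma> m) (\<gamma> n) = n - m"
proof -
  show "\<gamma> n \<in> verts G" "m \<le> n \<Longrightarrow> d (\<gamma> m) (\<gamma> n) = n - m" using assms unfolding geodesic_rays_def by auto
  have "\<gamma> 0 = p" "\<forall>m n. m \<le> n \<longrightarrow> d (\<gamma> m) (\<gamma> n) = n - m" using assms unfolding geodesic_rays_def by auto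
  from this(2)[rule_format, of 0 n] this(1) show "d p (\<gamma> n) = n" by simp
qed

text \<open>If \<open>xy\<close> is the largest of \<open>xy\<close>, \<open>yz\<close>,
  \<open>qx\<close>, \<open>qz\<close>, then both minima containing it equal their other entry, so
  \<open>xz \<ge> yz - \<delta>\<close> and \<open>qy \<ge> qx - \<delta>\<close>, which add up to
  the second alternative. If \<open>qz\<close> is largest, the second alternative follows too;
  \<open>yz\<close> or \<open>qx\<close> gives the first.\<close>

lemma four_point:
  fixes xy xz yz qx qy qz \<delta> :: real
  assumes "xz \<ge> min xy yz - \<delta>" "xz \<ge> min qx qz - \<delta>"
    and "qy \<ge> min qx xy - \<delta>" "qy \<ge> min qz yz - \<delta>"
  shows "xz + qy \<ge> xy + qz - 2 * \<delta> \<or> xz + qy \<ge> yz + qx - 2 * \<delta>"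
  using assms unfolding min_def by (simp split: if_splits)

text \<open>Replacing the base point \<open>p\<close> by \<open>q\<close> turns the three-point inequality for \<open>p\<close> into a
  four-point inequality, which is the lemma \<open>four_point\<close>.\<close>

lemma gromov_hyperbolic_basepoint:
  assumes p: "p \<in> verts G"
    and hyp: "\<And>x y z. \<lbrakk>x \<in> verts G; y \<in> verts G; z \<in> verts G\<rbrakk> \<Longrightarrow>
      gromov_product G p x z \<ge> min (gromov_product G p x y) (gromov_product G p y z) - \<delta>"
    and "\<delta> \<ge> 0"
  shows "gromov_hyperbolic G"
proof -
  let ?g = "gromov_product G p"
  have sym: "?g x y = ?g y x" for x y unfolding gromov_product_def by (simp add: dist_sym)
  \<comment> \<open>Substituting this, the terms that depend on \<open>q\<close> and the two outer
    points cancel, and the inequality at \<open>q\<close> compares sums of two products at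
    \<open>p\<close>.\<close>
  have change: "gromov_product G q x y = ?g x y - ?g q x - ?g q y + d p q" for q x y
    unfolding gromov_product_def using dist_sym[of q x] dist_sym[of q y] by (simp add: field_simps)
  have "gromov_product G q x z \<ge> min (gromov_product G q x y) (gromov_product G q y z) - 2 * \<delta>"
    if V: "q \<in> verts G" "x \<in> verts G" "y \<in> verts G" "z \<in> verts G" for q x y z
  proof -
    have "?g x z \<ge> min (?g x y) (?g y z) - \<delta>" "?g x z \<ge> min (?g q x) (?g q z) - \<delta>"
      "?g q y \<ge> min (?g q x) (?g x y) - \<delta>" "?g q y \<ge> min (?g q z) (?g y z) - \<delta>"
      using hyp[of x y z] hyp[of x q z] hyp[of q x y] hyp[of q z y] V sym[of x q] sym[of z y] by simp_all
    from four_point[OF this]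
    have "?g x z + ?g q y \<ge> ?g x y + ?g q z - 2 * \<delta> \<or>
        ?g x z + ?g q y \<ge> ?g y z + ?g q x - 2 * \<delta>" .
    then show ?thesis unfolding change[of q] by linarith
  qed
  with connected \<open>\<delta> \<ge> 0\<close> show ?thesis unfolding gromov_hyperbolic_def
    by (intro conjI exI[of _ "2 * \<delta>"]) auto
qed

end

section \<open>Augmented trees\<close>

text \<open>The graph enters only through its horizontal relation \<open>E\<close>, which keeps the
  metric argument independent of the construction of expansions. Parents are taken by
  \<open>butlast\<close>, so the conditions make sense at the root too. \<open>E_parent\<close> only
  says that horizontal distances do not grow towards the root; \<open>contraction\<close> makes long
  ones shrink.\<close>

locale augmented_tree =
  fixes G :: "('l list, 'b) pre_digraph" and E :: "'l list rel"
  assumes nil: "[] \<in> verts G"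
    and prefix_closed: "u @ [x] \<in> verts G \<Longrightarrow> u \<in> verts G"
    and E_verts: "(u, v) \<in> E \<Longrightarrow> u \<in> verts G"
    and E_length: "(u, v) \<in> E \<Longrightarrow> length u = length v"
    and E_sym: "sym E"
    and neighbours_iff: "(u, v) \<in> neighbours G \<longleftrightarrow>
      (u, v) \<in> E \<or> u \<in> verts G \<and> v \<in> verts G \<and> (\<exists>x. v = u @ [x] \<or> u = v @ [x])"
    and E_parent: "(u, v) \<in> E \<Longrightarrow> (butlast u, butlast v) \<in> E\<^sup>="
    and contraction: "(u, v) \<in> (E\<^sup>=) ^^ 3 \<Longrightarrow> (butlast u, butlast v) \<in> (E\<^sup>=) ^^ 2"
begin

text \<open>With the reflexive closure, \<open>h ^^ a\<close> expresses horizontal distance at most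
  \<open>a\<close>, and loops in \<open>E\<close> do no harm.\<close>

abbreviation h where "h \<equiv> E\<^sup>="

section \<open>Horizontal paths and their images among ancestors\<close>

lemma hpow_sym: "(u, v) \<in> h ^^ a \<Longrightarrow> (v, u) \<in> h ^^ a"
  by (rule relpow_sym) (use E_sym in \<open>auto simp: sym_def\<close>)

lemma hpow_mono: "(u, v) \<in> h ^^ a \<Longrightarrow> a \<le> b \<Longrightarrow> (u, v) \<in> h ^^ b"
  using relpow_reflcl_mono[of a b E] by blast

lemma hpow_trans: "(u, v) \<in> h ^^ a \<Longrightarrow> (v, w) \<in> h ^^ b \<Longrightarrow> (u, w) \<in> h ^^ (a + b)"
  by (auto simp: relpow_add)

lemma hpow_length: "(u, v) \<in> h ^^ a \<Longrightarrow> length u = length v"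
proof (induction a arbitrary: v)
  case (Suc a)
  then obtain z where "(u, z) \<in> h ^^ a" "(z, v) \<in> h" by auto
  with Suc.IH E_length show ?case by auto
qed simp

lemma hpow_butlast: "(u, v) \<in> h ^^ a \<Longrightarrow> (butlast u, butlast v) \<in> h ^^ a"
proof (induction a arbitrary: v)
  case (Suc a)
  then obtain z where z: "(u, z) \<in> h ^^ a" "(z, v) \<in> h" by auto
  have "(butlast z, butlast v) \<in> h" using z(2) E_parent by auto
  with Suc.IH[OF z(1)] show ?case by auto
qed simp

lemma butlast_funpow_take: "(butlast ^^ j) u = take (length u - j) u"
  by (induction j) (auto simp: butlast_take)

lemma take_via_butlast: "k \<le> length u \<Longrightarrow> take k u = (butlast ^^ (length u - k)) u"
  by (simp add: butlast_funpow_take)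

lemma hpow_butlast_funpow: "(u, v) \<in> h ^^ a \<Longrightarrow> ((butlast ^^ j) u, (butlast ^^ j) v) \<in> h ^^ a"
  by (induction j) (auto intro: hpow_butlast)

lemma hpow_take: "(u, v) \<in> h ^^ a \<Longrightarrow> (take k u, take k v) \<in> h ^^ a"
proof (cases "k \<le> length u")
  case True
  assume *: "(u, v) \<in> h ^^ a"
  with hpow_length[OF *] True show ?thesis
    by (simp add: take_via_butlast hpow_butlast_funpow)
qed (use hpow_length in force)

lemma hpow_contract1:
  assumes "(u, v) \<in> h ^^ Suc a" "a \<ge> 2"
  shows "(butlast u, butlast v) \<in> h ^^ a"
proof -
  have "Suc a = 3 + (a - 2)" using assms(2) by simp
  with assms(1) obtain z where z: "(u, z) \<in> h ^^ 3" "(z, v) \<in> h ^^ (a - 2)"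
    by (metis relcomp.cases relpow_add prod.inject)
  show ?thesis using hpow_trans[OF contraction[OF z(1)] hpow_butlast[OF z(2)]] assms(2)
    by (simp only: le_add_diff_inverse)
qed

text \<open>A path of at least six steps contains two disjoint pieces of three steps, and each of
  them loses one step at the parents.\<close>

lemma hpow_contract2:
  assumes "(u, v) \<in> h ^^ (a + 2)" "a \<ge> 4"
  shows "(butlast u, butlast v) \<in> h ^^ a"
proof -
  have "a + 2 = 3 + (a - 1)" using assms(2) by simp
  with assms(1) obtain z where z: "(u, z) \<in> h ^^ 3" "(z, v) \<in> h ^^ (a - 1)"
    by (metis relcomp.cases relpow_add prod.inject)
  have "(butlast z, butlast v) \<in> h ^^ (a - 2)"
    by (rule hpow_contract1) (use z(2) assms(2) in \<open>simp_all add: Suc_diff_Suc numeral_2_eq_2\<close>)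
  moreover have "2 \<le> a" using assms(2) by simp
  ultimately show ?thesis using hpow_trans[OF contraction[OF z(1)]] by (metis le_add_diff_inverse)
qed

lemma hpow_ancestors:
  assumes "(u, v) \<in> h ^^ (2 + j)"
  shows "(take (length u - j) u, take (length u - j) v) \<in> h ^^ 2"
proof -
  have "((butlast ^^ j) u, (butlast ^^ j) v) \<in> h ^^ 2"
    using assms
  proof (induction j arbitrary: u v)
    case (Suc j)
    have "(butlast u, butlast v) \<in> h ^^ (2 + j)" by (rule hpow_contract1) (use Suc.prems in auto)
    then show ?case using Suc.IH[of "butlast u" "butlast v"] by (simp add: funpow_swap1)
  qed simp
  with hpow_length[OF assms] show ?thesis by (simp add: butlast_funpow_take)
qed

text \<open>Passing to the parents on both sides costs two vertical edges, so two horizontal ones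
  should be saved in return; the rate of one per level in \<open>hpow_ancestors\<close> would leave
  an error growing with \<open>a\<close>. A remainder of at most five steps needs at most three more
  levels, whence the 6.\<close>

lemma hpow_ancestors_fast:
  assumes "(u, v) \<in> h ^^ a"
  shows "\<exists>j. 2 * j \<le> a + 6 \<and> (take (length u - j) u, take (length u - j) v) \<in> h ^^ 2"
proof -
  have "\<exists>j. 2 * j \<le> a + 6 \<and> ((butlast ^^ j) u, (butlast ^^ j) v) \<in> h ^^ 2"
    using assms
  proof (induction a arbitrary: u v rule: less_induct)
    case (less a)
    show ?case
    proof (cases "a \<ge> 6")
      case True
      then have "a - 2 + 2 = a" by simp
      with less.prems have "(u, v) \<in> h ^^ (a - 2 + 2)" by (simp only:)
      then have "(butlast u, butlast v) \<in> h ^^ (a - 2)"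
        by (rule hpow_contract2) (use True in simp)
      from less.IH[OF _ this] True obtain j where j: "2 * j \<le> a - 2 + 6"
        "((butlast ^^ j) (butlast u), (butlast ^^ j) (butlast v)) \<in> h ^^ 2" by auto
      then show ?thesis using True by (intro exI[of _ "Suc j"]) (simp add: funpow_swap1)
    next
      case False
      then have uv: "(u, v) \<in> h ^^ (2 + 3)" by (intro hpow_mono[OF less.prems]) simp
      from hpow_ancestors[OF uv] hpow_length[OF uv] show ?thesis
        by (intro exI[of _ 3]) (simp add: butlast_funpow_take)
    qed
  qed
  with hpow_length[OF assms] show ?thesis by (simp add: butlast_funpow_take)
qed

text \<open>Paths can be straightened to go up, then horizontally, then down.\<close>

lemma path_normal_form:
  assumes "(x, y) \<in> neighbours G ^^ n"
  shows "\<exists>k a. k \<le> length x \<and> k \<le> length y \<and> (take k x, take k y) \<in> h ^^ a \<and>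
    length x + length y + a \<le> n + 2 * k"
  using assms
proof (induction n arbitrary: y)
  case 0
  then show ?case by (intro exI[of _ "length x"] exI[of _ 0]) auto
next
  case (Suc n)
  then obtain z where "(x, z) \<in> neighbours G ^^ n" and zy: "(z, y) \<in> neighbours G" by auto
  from Suc.IH[OF this(1)] obtain k a where k: "k \<le> length x" "k \<le> length z"
    "(take k x, take k z) \<in> h ^^ a" "length x + length z + a \<le> n + 2 * k" by blast
  consider "(z, y) \<in> E" | b where "y = z @ [b]" | b where "z = y @ [b]"
    using zy unfolding neighbours_iff by blast
  then show ?case
  proof cases
    case 1
    have "(take k z, take k y) \<in> h ^^ 1" using hpow_take[of z y 1 k] 1 by simp
    from hpow_trans[OF k(3) this] k E_length[OF 1] show ?thesis
      by (intro exI[of _ k] exI[of _ "Suc a"]) simp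
  next
    case 2
    with k show ?thesis by (intro exI[of _ k] exI[of _ a]) simp
  next
    case 3
    show ?thesis
    proof (cases "k = length z")
      case False
      with k 3 show ?thesis by (intro exI[of _ k] exI[of _ a]) simp
    next
      \<comment> \<open>The end of the path has no downward part that the upward step could cancel,
        so the horizontal piece itself is projected one level up.\<close>
      case True
      have "(take (length y) (take k x), take (length y) (take k z)) \<in> h ^^ a"
        by (rule hpow_take) (rule k(3))
      with True k 3 show ?thesis by (intro exI[of _ "length y"] exI[of _ a]) (simp add: min_def)
    qed
  qed
qed

lemma path_to_ancestor: "u \<in> verts G \<Longrightarrow> (u, take k u) \<in> neighbours G ^^ (length u - k)"
proof (induction u rule: rev_induct)
  case (snoc x u)
  show ?case
  proof (cases "k \<le> length u")
    case True
    have "u \<in> verts G" using snoc.prems prefix_closed by blast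
    with snoc have "(u @ [x], u) \<in> neighbours G" "(u, take k u) \<in> neighbours G ^^ (length u - k)"
      by (auto simp: neighbours_iff)
    from relpow_Suc_I2[OF this] True show ?thesis by (simp add: Suc_diff_le del: relpow.simps)
  qed simp
qed simp

lemma hpow_path: "(u, v) \<in> h ^^ a \<Longrightarrow> \<exists>b\<le>a. (u, v) \<in> neighbours G ^^ b"
proof (induction a arbitrary: v)
  case (Suc a)
  then obtain z where z: "(u, z) \<in> h ^^ a" "(z, v) \<in> h" by auto
  from Suc.IH[OF z(1)] obtain b where b: "b \<le> a" "(u, z) \<in> neighbours G ^^ b" by blast
  show ?case
  proof (cases "z = v")
    case True
    with b show ?thesis using le_SucI by blast
  next
    case False
    with z(2) have "(z, v) \<in> neighbours G" by (auto simp: neighbours_iff)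
    with b show ?thesis by (intro exI[of _ "Suc b"]) auto
  qed
qed simp

lemma path_via_ancestors:
  assumes "u \<in> verts G" "v \<in> verts G" "(take k u, take k v) \<in> h ^^ a"
  shows "\<exists>n \<le> (length u - k) + (length v - k) + a. (u, v) \<in> neighbours G ^^ n"
proof -
  obtain b where b: "b \<le> a" "(take k u, take k v) \<in> neighbours G ^^ b" using hpow_path[OF assms(3)] by blast
  have "(u, v) \<in> neighbours G ^^ ((length u - k) + b + (length v - k))"
    using path_to_ancestor[OF assms(1), of k] b(2)
      relpow_sym[OF sym_neighbours path_to_ancestor[OF assms(2), of k]]
    by (auto simp: relpow_add)
  with b(1) show ?thesis by (intro exI[of _ "(length u - k) + b + (length v - k)"]) auto
qed

lemma E_verts2: "(u, v) \<in> E \<Longrightarrow> v \<in> verts G"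
  using E_sym E_verts by (meson symD)

sublocale connected_digraph G
proof
  fix e assume "e \<in> arcs G"
  then have "(tail G e, head G e) \<in> neighbours G" unfolding neighbours_def arcs_ends_conv by auto
  then show "tail G e \<in> verts G" "head G e \<in> verts G"
    unfolding neighbours_iff using E_verts E_verts2 by auto
next
  show "connected_graph G" unfolding connected_graph_def
  proof (intro ballI)
    fix x y assume "x \<in> verts G" "y \<in> verts G"
    then show "\<exists>n. (x, y) \<in> neighbours G ^^ n" using path_via_ancestors[of x y 0 0] by auto
  qed
qed

section \<open>Nearness, distance and the Gromov product\<close>

definition near where
  "near k u v \<longleftrightarrow> k \<le> length u \<and> k \<le> length v \<and> (take k u, take k v) \<in> h ^^ 2"

lemma dist_upper:
  "u \<in> verts G \<Longrightarrow> v \<in> verts G \<Longrightarrow> (take k u, take k v) \<in> h ^^ a \<Longrightarrow>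
    d u v \<le> (length u - k) + (length v - k) + a"
  using path_via_ancestors[of u v k a] dist_le[of u v] by (meson order_trans)

text \<open>The normal form of a geodesic has a horizontal piece of length \<open>a\<close>. Lifting
  it by \<open>j\<close> levels until it has length at most 2 costs
  \<open>2 * j \<le> a + 6\<close>, of which \<open>a\<close> is already paid for by the length of
  the path.\<close>

lemma near_exists:
  assumes "u \<in> verts G" "v \<in> verts G"
  shows "\<exists>k. near k u v \<and> length u + length v \<le> d u v + 2 * k + 6"
proof -
  obtain k a where k: "k \<le> length u" "k \<le> length v" "(take k u, take k v) \<in> h ^^ a"
    "length u + length v + a \<le> d u v + 2 * k"
    using path_normal_form[OF dist_path[OF assms]] by blast
  have "length (take k u) = k" using k(1) by simp
  from hpow_ancestors_fast[OF k(3), unfolded this] obtain j where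
    j: "2 * j \<le> a + 6" "(take (k - j) (take k u), take (k - j) (take k v)) \<in> h ^^ 2" by blast
  have "(take (k - j) u, take (k - j) v) \<in> h ^^ 2" using j(2) by (simp only: take_take min.absorb1 diff_le_self)
  then have "near (k - j) u v" using k(1,2) unfolding near_def by linarith
  with k j(1) show ?thesis by (intro exI[of _ "k - j"]) auto
qed

lemma near_dist:
  assumes "u \<in> verts G" "v \<in> verts G" "near k u v"
  shows "d u v + 2 * k \<le> length u + length v + 2"
proof -
  have k: "k \<le> length u" "k \<le> length v" "(take k u, take k v) \<in> h ^^ 2"
    using assms(3) unfolding near_def by auto
  from dist_upper[OF assms(1,2) k(3)] k(1,2) show ?thesis by linarith
qed

lemma near_sym: "near k u v \<Longrightarrow> near k v u"
  unfolding near_def using hpow_sym by auto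

lemma near_mono: "near k u v \<Longrightarrow> j \<le> k \<Longrightarrow> near j u v"
  unfolding near_def using hpow_take[of "take k u" "take k v" 2 j] by (auto simp: min_def)

text \<open>Two horizontal pieces join to one of length 4, and each of two levels upwards removes
  one step. For \<open>k < 2\<close> the truncated difference is the root level.\<close>

lemma near_trans:
  assumes "near k u v" "near k v w"
  shows "near (k - 2) u w"
proof -
  have k: "k \<le> length u" "k \<le> length w" "(take k u, take k w) \<in> h ^^ (2 + 2)"
    using assms hpow_trans unfolding near_def by blast+
  have "length (take k u) = k" using k(1) by simp
  from hpow_ancestors[OF k(3), unfolded this] have "(take (k - 2) u, take (k - 2) w) \<in> h ^^ 2"
    by (simp only: take_take min.absorb1 diff_le_self)
  with k(1,2) show ?thesis unfolding near_def by auto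
qed

lemma length_le_dist:
  assumes "u \<in> verts G" "v \<in> verts G"
  shows "length u \<le> length v + d u v"
proof -
  obtain k a where "k \<le> length u" "k \<le> length v" "length u + length v + a \<le> d u v + 2 * k"
    using path_normal_form[OF dist_path[OF assms]] by blast
  then show ?thesis by simp
qed

lemma dist_nil: "u \<in> verts G \<Longrightarrow> d [] u = length u"
  using dist_upper[of "[]" u 0 0] length_le_dist[of u "[]"] nil dist_sym[of u "[]"] by simp

text \<open>The errors 1 and 3 are half of the constants 2 in \<open>near_dist\<close> and 6 in
  \<open>near_exists\<close>.\<close>

lemma near_gromov_product:
  assumes "u \<in> verts G" "v \<in> verts G"
  shows "near k u v \<Longrightarrow> real k - 1 \<le> gromov_product G [] u v"
    and "\<exists>k. near k u v \<and> gromov_product G [] u v \<le> real k + 3"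
proof -
  have g: "2 * gromov_product G [] u v = real (length u) + real (length v) - real (d u v)"
    unfolding gromov_product_def using assms dist_nil by simp
  show "real k - 1 \<le> gromov_product G [] u v" if "near k u v"
    using near_dist[OF assms that] g by linarith
  obtain k where k: "near k u v" "length u + length v \<le> d u v + 2 * k + 6"
    using near_exists[OF assms] by blast
  have "real (length u + length v) \<le> real (d u v + 2 * k + 6)"
    using k(2) by (rule of_nat_mono)
  with g have "gromov_product G [] u v \<le> real k + 3" by simp
  with k(1) show "\<exists>k. near k u v \<and> gromov_product G [] u v \<le> real k + 3" by blast
qed

theorem hyperbolic: "gromov_hyperbolic G"
proof (rule gromov_hyperbolic_basepoint[OF nil])
  fix x y z assume V: "x \<in> verts G" "y \<in> verts G" "z \<in> verts G"
  obtain k where k: "near k x y" "gromov_product G [] x y \<le> real k + 3"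
    using near_gromov_product(2) V by blast
  obtain l where l: "near l y z" "gromov_product G [] y z \<le> real l + 3"
    using near_gromov_product(2) V by blast
  \<comment> \<open>The resulting constant 6 consists of 2 from transitivity, 1 from the lower and 3
    from the upper estimate of the Gromov product.\<close>
  have "near (min k l - 2) x z" using near_trans near_mono k(1) l(1)
    by (metis min.cobounded1 min.cobounded2)
  from near_gromov_product(1)[OF V(1,3) this]
  have "real (min k l) - 3 \<le> gromov_product G [] x z" by linarith
  with k(2) l(2) show "min (gromov_product G [] x y) (gromov_product G [] y z) - 6 \<le> gromov_product G [] x z"
    by linarith
qed simp

end

section \<open>Coding the boundary of an augmented tree\<close>

definition infinite_words :: "'a list set \<Rightarrow> (nat \<Rightarrow> 'a) set" where
  "infinite_words W = {x. \<forall>n. prefix_of n x \<in> W}"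

definition cylinder_topology :: "(nat \<Rightarrow> 'a) set \<Rightarrow> (nat \<Rightarrow> 'a) topology" where
  "cylinder_topology \<Omega> = topology_generated_by {{x \<in> \<Omega>. prefix_of (length w) x = w} |w. True}"

lemma take_prefix_of: "take k (prefix_of n x) = prefix_of (min k n) x"
  by (cases "k \<le> n") (simp_all add: take_map take_upt min_def)

lemma prefix_of_mono: "prefix_of n x = prefix_of n y \<Longrightarrow> k \<le> n \<Longrightarrow> prefix_of k x = prefix_of k y"
  using take_prefix_of[of k x n] take_prefix_of[of k y n] by (simp add: min_def)

lemma openin_cylinder_topology:
  "openin (cylinder_topology \<Omega>) U \<longleftrightarrow>
    U \<subseteq> \<Omega> \<and> (\<forall>x\<in>U. \<exists>k. \<forall>y\<in>\<Omega>. prefix_of k y = prefix_of k x \<longrightarrow> y \<in> U)" (is "?L \<longleftrightarrow> ?R")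
proof
  assume ?L
  then have "generate_topology_on {{x \<in> \<Omega>. prefix_of (length w) x = w} |w. True} U"
    unfolding cylinder_topology_def openin_topology_generated_by_iff .
  then show ?R
  proof induction
    case (Int a b)
    show ?case
    proof (intro conjI ballI)
      fix x assume x: "x \<in> a \<inter> b"
      with Int.IH obtain k l where k: "\<forall>y\<in>\<Omega>. prefix_of k y = prefix_of k x \<longrightarrow> y \<in> a"
        "\<forall>y\<in>\<Omega>. prefix_of l y = prefix_of l x \<longrightarrow> y \<in> b" by blast
      show "\<exists>k. \<forall>y\<in>\<Omega>. prefix_of k y = prefix_of k x \<longrightarrow> y \<in> a \<inter> b"
      proof (intro exI ballI impI)
        fix y assume "y \<in> \<Omega>" and *: "prefix_of (max k l) y = prefix_of (max k l) x"
        with k prefix_of_mono[OF *, of k] prefix_of_mono[OF *, of l] show "y \<in> a \<inter> b"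
          by (simp del: map_eq_conv)
      qed
    qed (use Int.IH in blast)
  next
    case (UN K)
    then show ?case by (meson Sup_least UnionE UnionI)
  next
    case (Basis s)
    then obtain w where "s = {x \<in> \<Omega>. prefix_of (length w) x = w}" by blast
    then show ?case by (auto intro!: exI[of _ "length w"] simp del: map_eq_conv)
  qed simp
next
  assume R: ?R
  have "\<exists>T. openin (cylinder_topology \<Omega>) T \<and> x \<in> T \<and> T \<subseteq> U" if "x \<in> U" for x
  proof -
    from R that obtain k where k: "\<forall>y\<in>\<Omega>. prefix_of k y = prefix_of k x \<longrightarrow> y \<in> U" by blast
    let ?T = "{y \<in> \<Omega>. prefix_of (length (prefix_of k x)) y = prefix_of k x}"
    have "openin (cylinder_topology \<Omega>) ?T" unfolding cylinder_topology_def
      by (rule topology_generated_by_Basis) blast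
    then show ?thesis using k R that by (intro exI[of _ ?T]) auto
  qed
  then show ?L by (subst openin_subopen) blast
qed

lemma topspace_cylinder_topology: "topspace (cylinder_topology \<Omega>) = \<Omega>"
proof (rule antisym)
  show "topspace (cylinder_topology \<Omega>) \<subseteq> \<Omega>"
    using openin_topspace[of "cylinder_topology \<Omega>"] unfolding openin_cylinder_topology by simp
  have "openin (cylinder_topology \<Omega>) \<Omega>" unfolding openin_cylinder_topology by blast
  then show "\<Omega> \<subseteq> topspace (cylinder_topology \<Omega>)" by (rule openin_subset)
qed

text \<open>The invariant is that infinitely many \<open>w n\<close> begin with the prefix built so
  far. Only finitely many of these are too short to be prolonged, and there are finitely many words
  of the next length, so some prolongation preserves it. The conclusion is phrased with infinitely
  many \<open>n\<close> so that each prefix of \<open>x\<close> is met by arbitrarily late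
  terms.\<close>

lemma koenig_subsequence:
  fixes w :: "nat \<Rightarrow> 'a list"
  assumes W: "\<And>u a. u @ [a] \<in> W \<Longrightarrow> u \<in> W" "\<And>n. finite {u \<in> W. length u = n}"
    and w: "\<And>n. w n \<in> W" "\<And>k. finite {n. length (w n) < k}"
  shows "\<exists>x\<in>infinite_words W. \<forall>k. infinite {n. take k (w n) = prefix_of k x}"
proof -
  have takeW: "take k u \<in> W" if "u \<in> W" for k u
    using that
  proof (induction u rule: rev_induct)
    case (snoc a u)
    then show ?case using W(1)[of u a] by (cases "k \<le> length u") auto
  qed simp
  have "\<exists>f. \<forall>k. infinite {n. take k (w n) = f k} \<and> (\<exists>a. f (Suc k) = f k @ [a])"
  proof (rule dependent_nat_choice)
    show "\<exists>u. infinite {n. take 0 (w n) = u}" by (intro exI[of _ "[]"]) simp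
  next
    fix u k assume inf: "infinite {n. take k (w n) = u}"
    let ?A = "{n. take k (w n) = u} - {n. length (w n) < Suc k}"
    have A: "infinite ?A" using inf w(2) by (meson Diff_infinite_finite)
    have "(\<lambda>n. take (Suc k) (w n)) ` ?A \<subseteq> {u \<in> W. length u = Suc k}"
      using takeW w(1) by auto
    then have "finite ((\<lambda>n. take (Suc k) (w n)) ` ?A)" using W(2) finite_subset by blast
    from pigeonhole_infinite[OF A this] obtain m where m: "m \<in> ?A"
      "infinite {n \<in> ?A. take (Suc k) (w n) = take (Suc k) (w m)}" by blast
    have "infinite {n. take (Suc k) (w n) = take (Suc k) (w m)}"
      using m(2) by (rule contrapos_nn) (auto elim: finite_subset[rotated])
    moreover have "take (Suc k) (w m) = u @ [w m ! k]"
      using m(1) by (auto simp: take_Suc_conv_app_nth)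
    ultimately show "\<exists>v. infinite {n. take (Suc k) (w n) = v} \<and> (\<exists>a. v = u @ [a])" by metis
  qed
  then obtain f where f: "\<And>k. infinite {n. take k (w n) = f k}" "\<And>k. \<exists>a. f (Suc k) = f k @ [a]"
    by blast
  define x where "x k = last (f (Suc k))" for k
  have "f 0 = []" using f(1)[of 0] by (metis (mono_tags, lifting) Collect_empty_eq finite.emptyI take0)
  have prefix: "prefix_of k x = f k" for k
  proof (induction k)
    case (Suc k)
    obtain a where "f (Suc k) = f k @ [a]" using f(2) by blast
    with Suc show ?case by (simp add: x_def)
  qed (simp add: \<open>f 0 = []\<close>)
  have "f k \<in> W" for k
    using f(1)[of k] takeW w(1) by (metis (mono_tags, lifting) Collect_empty_eq finite.emptyI)
  then have "x \<in> infinite_words W" by (simp add: infinite_words_def prefix)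
  with f(1) show ?thesis unfolding prefix[symmetric] by blast
qed

text \<open>\<open>W\<close> is a finitely branching tree of codes, whose letters \<open>emb\<close>
  turns into letters of \<open>G\<close>. The coded words need not exhaust the vertices;
  \<open>W_dense\<close> makes them meet every horizontal neighbourhood of radius 1, so rays outside
  the coded part still have companions inside it.\<close>

locale coded_augmented_tree = augmented_tree G E
  for G :: "('l list, 'b) pre_digraph" and E +
  fixes W :: "'a list set" and emb :: "'a \<Rightarrow> 'l"
  assumes W_prefix_closed: "u @ [a] \<in> W \<Longrightarrow> u \<in> W"
    and W_verts: "u \<in> W \<Longrightarrow> map emb u \<in> verts G"
    and W_finite: "finite {u \<in> W. length u = n}"
    and W_dense: "v \<in> verts G \<Longrightarrow> \<exists>u\<in>W. (v, map emb u) \<in> E\<^sup>="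
begin

abbreviation \<Omega> where "\<Omega> \<equiv> infinite_words W"

definition ray where "ray x n = map emb (prefix_of n x)"

definition glued where
  "glued = {(x, y). x \<in> \<Omega> \<and> y \<in> \<Omega> \<and> (\<forall>n. (ray x n, ray y n) \<in> h ^^ 2)}"

lemma length_ray [simp]: "length (ray x n) = n"
  by (simp add: ray_def)

lemma take_ray: "take k (ray x n) = ray x (min k n)"
  by (simp only: ray_def take_map[of k emb] take_prefix_of)

lemma ray_Suc: "ray x (Suc n) = ray x n @ [emb (x n)]"
  by (simp add: ray_def)

lemma ray_verts: "x \<in> \<Omega> \<Longrightarrow> ray x n \<in> verts G"
  unfolding ray_def infinite_words_def using W_verts by blast

lemma ray_step: "x \<in> \<Omega> \<Longrightarrow> (ray x n, ray x (Suc n)) \<in> neighbours G"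
  using ray_verts ray_Suc unfolding neighbours_iff by metis

lemma hpow_rays_mono: "(ray x n, ray y n) \<in> h ^^ a \<Longrightarrow> k \<le> n \<Longrightarrow> (ray x k, ray y k) \<in> h ^^ a"
  using hpow_take[of "ray x n" "ray y n" a k] by (simp add: take_ray min_def)

lemma dist_same_ray:
  assumes "x \<in> \<Omega>"
  shows "d (ray x m) (ray x n) \<le> m + n - 2 * min m n"
proof -
  have "d (ray x m) (ray x n) \<le> (m - min m n) + (n - min m n) + 0"
    using dist_upper[OF ray_verts[OF assms] ray_verts[OF assms], of "min m n" m n 0]
    by (simp add: take_ray)
  then show ?thesis by simp
qed

lemma glued_iff_bounded:
  assumes "x \<in> \<Omega>" "y \<in> \<Omega>"
  shows "(x, y) \<in> glued \<longleftrightarrow> (\<exists>K. \<forall>n. d (ray x n) (ray y n) \<le> K)"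
proof
  assume "(x, y) \<in> glued"
  then have "(take n (ray x n), take n (ray y n)) \<in> h ^^ 2" for n
    by (simp add: glued_def take_ray)
  then have "d (ray x n) (ray y n) \<le> 2" for n
    using dist_upper[OF ray_verts[OF assms(1)] ray_verts[OF assms(2)], of n n n 2] by simp
  then show "\<exists>K. \<forall>n. d (ray x n) (ray y n) \<le> K" by blast
next
  assume "\<exists>K. \<forall>n. d (ray x n) (ray y n) \<le> K"
  then obtain K where K: "\<And>n. d (ray x n) (ray y n) \<le> K" by blast
  have "(ray x m, ray y m) \<in> h ^^ 2" for m
  proof -
    \<comment> \<open>In \<open>near_exists\<close> the sum of the lengths is \<open>2 * ?n\<close>,
      which exceeds the bounded distance by enough to push the level of nearness to at least
      \<open>m\<close>.\<close>
    let ?n = "m + K + 6"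
    obtain k where k: "near k (ray x ?n) (ray y ?n)"
      "length (ray x ?n) + length (ray y ?n) \<le> d (ray x ?n) (ray y ?n) + 2 * k + 6"
      using near_exists[OF ray_verts[OF assms(1)] ray_verts[OF assms(2)]] by blast
    have "m \<le> k" using k(2) K[of ?n] by simp
    from near_mono[OF k(1) this] show ?thesis unfolding near_def by (simp add: take_ray min_def)
  qed
  with assms show "(x, y) \<in> glued" unfolding glued_def by blast
qed

section \<open>Boundary points seen from an arbitrary base point\<close>

context
  fixes p assumes p: "p \<in> verts G"
begin

text \<open>A discrete Busemann function: \<open>?f\<close> cannot increase along the vertical ray,
  so beyond a place \<open>c\<close> of its minimum the distance to \<open>p\<close> grows by
  exactly one in each step. A geodesic from \<open>p\<close> to that place, continued along the ray,
  is then a geodesic ray.\<close>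

lemma geodesic_ray_onto_ray:
  assumes x: "x \<in> \<Omega>"
  obtains \<gamma> M c where "\<gamma> \<in> geodesic_rays G p" "\<And>n. n \<ge> M \<Longrightarrow> \<gamma> n = ray x (n - M + c)"
proof -
  \<comment> \<open>The summand \<open>length p\<close> keeps the subtraction of naturals exact, by
    \<open>n_le\<close> below.\<close>
  let ?f = "\<lambda>n. d p (ray x n) + length p - n"
  obtain c where c: "\<And>n. ?f c \<le> ?f n" using ex_has_least_nat[of "\<lambda>_. True" _ ?f] by blast
  have n_le: "n \<le> d p (ray x n) + length p" for n
    using length_le_dist[OF ray_verts[OF x, of n] p] dist_sym[of p] by simp
  define M where "M = d p (ray x c)"
  have dist: "d p (ray x (c + n)) = M + n" for n
  proof (rule antisym)
    have "d p (ray x (c + n)) \<le> d p (ray x c) + d (ray x c) (ray x (c + n))"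
      using p ray_verts[OF x] by (intro dist_triangle)
    also have "d (ray x c) (ray x (c + n)) \<le> n" using dist_same_ray[OF x, of c "c + n"] by simp
    finally show "d p (ray x (c + n)) \<le> M + n" unfolding M_def by simp
    show "M + n \<le> d p (ray x (c + n))" using c[of "c + n"] n_le[of c] n_le[of "c + n"] unfolding M_def by linarith
  qed
  obtain \<sigma> where \<sigma>: "\<sigma> 0 = p" "\<sigma> M = ray x c" "\<And>i. i < M \<Longrightarrow> (\<sigma> i, \<sigma> (Suc i)) \<in> neighbours G"
    using dist_path[OF p ray_verts[OF x, of c]] unfolding relpow_fun_conv M_def by blast
  define \<gamma> where "\<gamma> n = (if n < M then \<sigma> n else ray x (n - M + c))" for n
  have step: "(\<gamma> n, \<gamma> (Suc n)) \<in> neighbours G" for n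
  proof -
    consider "Suc n < M" | "Suc n = M" | "M \<le> n" by linarith
    then show ?thesis
    proof cases
      case 2
      then show ?thesis using \<sigma>(2) \<sigma>(3)[of n] unfolding \<gamma>_def by simp
    next
      case 3
      then show ?thesis using ray_step[OF x, of "n - M + c"] unfolding \<gamma>_def by (simp add: Suc_diff_le)
    qed (use \<sigma>(3)[of n] in \<open>simp add: \<gamma>_def\<close>)
  qed
  have "\<gamma> \<in> geodesic_rays G p"
  proof (rule geodesic_rayI[of _ _ M])
    show "\<gamma> 0 = p" using \<sigma>(1,2) unfolding \<gamma>_def by auto
    show "range \<gamma> \<subseteq> verts G" using step neighbours_verts by blast
    show "d (\<gamma> n) (\<gamma> (Suc n)) \<le> 1" for n using dist_neighbour[OF step] .
    show "d p (\<gamma> n) = n" if "M \<le> n" for n using dist[of "n - M"] that unfolding \<gamma>_def by (simp add: add.commute)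
  qed
  then show thesis using that[of \<gamma> M c] unfolding \<gamma>_def by simp
qed

lemma geodesic_ray_length:
  assumes "\<gamma> \<in> geodesic_rays G p"
  shows "length (\<gamma> n) \<le> n + length p" "n \<le> length (\<gamma> n) + length p"
proof -
  note \<gamma> = geodesic_rayD(1,2)[OF assms, of n]
  show "length (\<gamma> n) \<le> n + length p"
    using length_le_dist[OF \<gamma>(1) p] \<gamma>(2) dist_sym[of p] by simp
  show "n \<le> length (\<gamma> n) + length p"
    using dist_upper[OF p \<gamma>(1), of 0 0] \<gamma>(2) by simp
qed

text \<open>Coded words next to the points \<open>\<gamma> n\<close> need not be prefixes of each
  other, so \<open>x\<close> is obtained as a limit of them. For fixed \<open>m\<close> there is a
  late \<open>n\<close> whose coded word agrees with \<open>x\<close> up to the length of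
  \<open>\<gamma> m\<close>; as \<open>\<gamma>\<close> is geodesic, \<open>\<gamma> m\<close> and
  \<open>\<gamma> n\<close> are near at level \<open>m\<close> up to a constant, and
  \<open>\<gamma> n\<close> can be exchanged for \<open>x\<close>.\<close>

lemma geodesic_ray_near_ray:
  assumes \<gamma>: "\<gamma> \<in> geodesic_rays G p"
  obtains x K where "x \<in> \<Omega>" "\<And>n. d (\<gamma> n) (ray x n) \<le> K"
proof -
  note V = geodesic_rayD(1)[OF \<gamma>] and len = geodesic_ray_length[OF \<gamma>]
  have "\<forall>n. \<exists>u\<in>W. (\<gamma> n, map emb u) \<in> h" using W_dense V by blast
  then obtain w where w: "\<And>n. w n \<in> W" "\<And>n. (\<gamma> n, map emb (w n)) \<in> h" by metis
  have len_w: "length (w n) = length (\<gamma> n)" for n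
    using hpow_length[of "\<gamma> n" "map emb (w n)" 1] w(2)[of n] by simp
  have fin: "finite {n. length (w n) < k}" for k
  proof (rule finite_subset)
    show "{n. length (w n) < k} \<subseteq> {..<k + length p}"
    proof
      fix n assume "n \<in> {n. length (w n) < k}"
      then show "n \<in> {..<k + length p}" using len(2)[of n] len_w[of n] by simp
    qed
  qed simp
  have "\<exists>x\<in>\<Omega>. \<forall>k. infinite {n. take k (w n) = prefix_of k x}"
    by (rule koenig_subsequence) (use W_prefix_closed W_finite w(1) fin in blast)+
  then obtain x where x: "x \<in> \<Omega>" and inf: "\<And>k. infinite {n. take k (w n) = prefix_of k x}" by blast
  have "d (\<gamma> m) (ray x m) \<le> 3 * length p + 9" for m
  proof -
    let ?k = "length (\<gamma> m)"
    obtain n where n: "n \<ge> m" "take ?k (w n) = prefix_of ?k x"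
      using inf[of ?k] unfolding infinite_nat_iff_unbounded_le by blast
    obtain l where l: "near l (\<gamma> m) (\<gamma> n)" "length (\<gamma> m) + length (\<gamma> n) \<le> d (\<gamma> m) (\<gamma> n) + 2 * l + 6"
      using near_exists V by blast
    have "d (\<gamma> m) (\<gamma> n) = n - m" using geodesic_rayD(3)[OF \<gamma> n(1)] .
    \<comment> \<open>The lengths of \<open>\<gamma> m\<close> and \<open>\<gamma> n\<close> fall
      below \<open>m\<close> and \<open>n\<close> by at most \<open>length p\<close> each, so
      \<open>2 * m \<le> 2 * l + 2 * length p + 6\<close>.\<close>
    with l(2) len(2)[of m] len(2)[of n] n(1) have l_ge: "m \<le> l + length p + 3" by linarith
    \<comment> \<open>Nearness is available up to level \<open>l\<close>, while
      \<open>ray x m\<close> has only \<open>m\<close> letters.\<close>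
    define j where "j = min l m"
    have lk: "l \<le> ?k" using l(1) unfolding near_def by simp
    have jk: "j \<le> ?k" using lk unfolding j_def by simp
    have "take j (w n) = prefix_of j x"
    proof -
      have "take j (w n) = take j (take ?k (w n))" using jk by (simp add: min_def)
      then show ?thesis unfolding n(2) using jk by (simp add: take_prefix_of min_def)
    qed
    then have wr: "take j (map emb (w n)) = ray x j" by (simp add: ray_def take_map)
    have "near j (\<gamma> m) (\<gamma> n)" using near_mono[OF l(1)] unfolding j_def by simp
    then have "(take j (\<gamma> m), take j (\<gamma> n)) \<in> h ^^ 2" unfolding near_def by blast
    moreover have "(take j (\<gamma> n), ray x j) \<in> h ^^ 1"
      using hpow_take[of "\<gamma> n" "map emb (w n)" 1 j] w(2)[of n] unfolding wr by simp
    ultimately have "(take j (\<gamma> m), ray x j) \<in> h ^^ (2 + 1)" by (rule hpow_trans)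
    moreover have "ray x j = take j (ray x m)" unfolding j_def by (simp add: take_ray min_def)
    ultimately have "d (\<gamma> m) (ray x m) \<le> (length (\<gamma> m) - j) + (length (ray x m) - j) + (2 + 1)"
      using dist_upper[OF V ray_verts[OF x], of j m m "2 + 1"] by (simp only:)
    also have "\<dots> \<le> 3 * length p + 9" using len(1)[of m] l_ge jk unfolding j_def length_ray by linarith
    finally show ?thesis .
  qed
  with x show thesis by (rule that)
qed

text \<open>For \<open>p\<close> other than the root, \<open>ray x\<close> does not start at
  \<open>p\<close> and is no member of its own boundary point. The point is therefore described by
  bounded distance from \<open>ray x\<close>.\<close>

definition end_of where
  "end_of x = {\<gamma> \<in> geodesic_rays G p. \<exists>K. \<forall>n. d (\<gamma> n) (ray x n) \<le> K}"

lemma end_ofI: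
  assumes \<gamma>: "\<gamma> \<in> geodesic_rays G p" and x: "x \<in> \<Omega>"
    and eq: "\<And>n. n \<ge> M \<Longrightarrow> \<gamma> n = ray x (n - M + c)"
  shows "\<gamma> \<in> end_of x"
proof -
  \<comment> \<open>From \<open>M\<close> on both sides run along the same vertical ray with a
    constant shift; before \<open>M\<close> only the length of \<open>\<gamma> n\<close> is known,
    which accounts for \<open>length p + 2 * M\<close>.\<close>
  have "d (\<gamma> n) (ray x n) \<le> length p + 2 * M + c" for n
  proof (cases "M \<le> n")
    case True
    then obtain k where k: "n = M + k" using le_Suc_ex by blast
    then have "d (\<gamma> n) (ray x n) \<le> (k + c) + (M + k) - 2 * min (k + c) (M + k)"
      using eq[OF True] dist_same_ray[OF x, of "k + c" "M + k"] by simp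
    then show ?thesis by (cases "c \<le> M") (simp_all add: min_def)
  next
    case False
    have "d (\<gamma> n) (ray x n) \<le> length (\<gamma> n) + n"
      using dist_upper[OF geodesic_rayD(1)[OF \<gamma>] ray_verts[OF x], of 0 n n 0] by simp
    with False geodesic_ray_length(1)[OF \<gamma>, of n] show ?thesis by simp
  qed
  with \<gamma> show ?thesis unfolding end_of_def by blast
qed

lemma asymptotic_class:
  assumes x: "x \<in> \<Omega>" and "\<gamma> \<in> end_of x"
  shows "asymptotic G p `` {\<gamma>} = end_of x"
proof -
  obtain K where \<gamma>: "\<gamma> \<in> geodesic_rays G p" and K: "\<And>n. d (\<gamma> n) (ray x n) \<le> K"
    using assms(2) unfolding end_of_def by blast
  have "\<exists>L. \<forall>n. d (\<gamma>' n) (ray x n) \<le> L"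
    if "\<gamma>' \<in> geodesic_rays G p" "\<forall>n. d (\<gamma> n) (\<gamma>' n) \<le> L" for \<gamma>' L
  proof (intro exI allI)
    fix n
    show "d (\<gamma>' n) (ray x n) \<le> L + K"
      using dist_triangle[OF geodesic_rayD(1)[OF that(1)] geodesic_rayD(1)[OF \<gamma>] ray_verts[OF x], of n n n]
        K[of n] that(2)[rule_format, of n] dist_sym[of "\<gamma>' n"] by simp
  qed
  moreover have "\<exists>L. \<forall>n. d (\<gamma> n) (\<gamma>' n) \<le> L"
    if "\<gamma>' \<in> geodesic_rays G p" "\<forall>n. d (\<gamma>' n) (ray x n) \<le> L" for \<gamma>' L
  proof (intro exI allI)
    fix n
    show "d (\<gamma> n) (\<gamma>' n) \<le> K + L"
      using dist_triangle[OF geodesic_rayD(1)[OF \<gamma>] ray_verts[OF x] geodesic_rayD(1)[OF that(1)], of n n n]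
        K[of n] that(2)[rule_format, of n] dist_sym[of "\<gamma>' n"] by simp
  qed
  ultimately show ?thesis using \<gamma> unfolding asymptotic_def end_of_def by blast
qed

lemma end_of_nonempty: "x \<in> \<Omega> \<Longrightarrow> \<exists>\<gamma>. \<gamma> \<in> end_of x"
  using geodesic_ray_onto_ray end_ofI by metis

lemma boundary_points_eq: "boundary_points G p = end_of ` \<Omega>"
proof
  show "end_of ` \<Omega> \<subseteq> boundary_points G p"
  proof
    fix \<xi> assume "\<xi> \<in> end_of ` \<Omega>"
    then obtain x where x: "x \<in> \<Omega>" "\<xi> = end_of x" by blast
    then obtain \<gamma> where "\<gamma> \<in> end_of x" using end_of_nonempty by blast
    with x show "\<xi> \<in> boundary_points G p" unfolding boundary_points_def
      using asymptotic_class[OF x(1)] by (metis (no_types, lifting) end_of_def mem_Collect_eq quotientI)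
  qed
  show "boundary_points G p \<subseteq> end_of ` \<Omega>"
  proof
    fix \<xi> assume "\<xi> \<in> boundary_points G p"
    then obtain \<gamma> where \<gamma>: "\<gamma> \<in> geodesic_rays G p" "\<xi> = asymptotic G p `` {\<gamma>}"
      unfolding boundary_points_def quotient_def by blast
    obtain x K where x: "x \<in> \<Omega>" "\<And>n. d (\<gamma> n) (ray x n) \<le> K" using geodesic_ray_near_ray[OF \<gamma>(1)] by metis
    with \<gamma> have "\<gamma> \<in> end_of x" unfolding end_of_def by blast
    from asymptotic_class[OF x(1) this] \<gamma>(2) x(1) show "\<xi> \<in> end_of ` \<Omega>" by blast
  qed
qed

lemma end_of_eq_iff:
  assumes x: "x \<in> \<Omega>" and y: "y \<in> \<Omega>"
  shows "end_of x = end_of y \<longleftrightarrow> (x, y) \<in> glued"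
proof -
  obtain \<gamma> where \<gamma>: "\<gamma> \<in> end_of x" using end_of_nonempty[OF x] by blast
  then obtain K where ray: "\<gamma> \<in> geodesic_rays G p" and K: "\<And>n. d (\<gamma> n) (ray x n) \<le> K"
    unfolding end_of_def by blast
  have "end_of x = end_of y \<longleftrightarrow> \<gamma> \<in> end_of y"
    using asymptotic_class[OF x \<gamma>] asymptotic_class[OF y, of \<gamma>] \<gamma> by blast
  also have "\<dots> \<longleftrightarrow> (\<exists>L. \<forall>n. d (ray x n) (ray y n) \<le> L)"
  proof
    assume "\<gamma> \<in> end_of y"
    then obtain L where L: "\<And>n. d (\<gamma> n) (ray y n) \<le> L" unfolding end_of_def by blast
    show "\<exists>L. \<forall>n. d (ray x n) (ray y n) \<le> L"
    proof (intro exI allI)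
      fix n show "d (ray x n) (ray y n) \<le> K + L"
        using dist_triangle[OF ray_verts[OF x] geodesic_rayD(1)[OF ray] ray_verts[OF y], of n n n]
          K[of n] L[of n] dist_sym[of "ray x n" "\<gamma> n"] by simp
    qed
  next
    assume "\<exists>L. \<forall>n. d (ray x n) (ray y n) \<le> L"
    then obtain L where L: "\<And>n. d (ray x n) (ray y n) \<le> L" by blast
    have "d (\<gamma> n) (ray y n) \<le> K + L" for n
      using dist_triangle[OF geodesic_rayD(1)[OF ray] ray_verts[OF x] ray_verts[OF y], of n n n]
        K[of n] L[of n] by simp
    with ray show "\<gamma> \<in> end_of y" unfolding end_of_def by blast
  qed
  also have "\<dots> \<longleftrightarrow> (x, y) \<in> glued" using glued_iff_bounded[OF x y] by simp
  finally show ?thesis .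
qed

section \<open>Comparison of the visual topology with the cylinder topology\<close>

lemma gromov_product_lower:
  assumes "u \<in> verts G" "v \<in> verts G" "k \<le> length u" "k \<le> length v" "take k u = take k v"
  shows "real k - real (length p) \<le> gromov_product G p u v"
proof -
  have "(take k u, take k v) \<in> h ^^ 0" using assms(5) by simp
  from dist_upper[OF assms(1,2) this] assms(3,4)
  have "d u v + 2 * k \<le> length u + length v" by linarith
  then have "real (d u v + 2 * k) \<le> real (length u + length v)" by (rule of_nat_mono)
  moreover have "real (length u) \<le> real (length p + d p u)" "real (length v) \<le> real (length p + d p v)"
    using length_le_dist[OF assms(1) p] length_le_dist[OF assms(2) p] dist_sym[of p]
    by (intro of_nat_mono; simp)+
  ultimately show ?thesis unfolding gromov_product_def by simp
qed

lemma gromov_product_upper: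
  assumes "u \<in> verts G" "v \<in> verts G"
  shows "\<exists>k. near k u v \<and> gromov_product G p u v \<le> real k + real (length p) + 3"
proof -
  obtain k where k: "near k u v" "length u + length v \<le> d u v + 2 * k + 6"
    using near_exists[OF assms] by blast
  have "real (length u + length v) \<le> real (d u v + 2 * k + 6)"
    using k(2) by (rule of_nat_mono)
  moreover have "real (d p u) \<le> real (length p + length u)" "real (d p v) \<le> real (length p + length v)"
    using dist_upper[OF p assms(1), of 0 0] dist_upper[OF p assms(2), of 0 0]
    by (intro of_nat_mono; simp)+
  ultimately have "gromov_product G p u v \<le> real k + real (length p) + 3"
    unfolding gromov_product_def by simp
  with k(1) show ?thesis by blast
qed

text \<open>A visual neighbourhood asks for just one pair of representatives. These can be chosen to
  run eventually along the vertical rays, where a common prefix of length \<open>k\<close> bounds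
  the Gromov product from below.\<close>

lemma open_preimage:
  assumes U: "visual_open G p U"
  shows "openin (cylinder_topology \<Omega>) {x \<in> \<Omega>. end_of x \<in> U}"
  unfolding openin_cylinder_topology
proof (intro conjI ballI)
  fix x assume "x \<in> {x \<in> \<Omega>. end_of x \<in> U}"
  then have x: "x \<in> \<Omega>" "end_of x \<in> U" by auto
  then obtain r where r: "visual_nbhd G p (end_of x) r \<subseteq> U" using U unfolding visual_open_def by blast
  \<comment> \<open>The summand \<open>length p\<close> makes up for the loss in
    \<open>gromov_product_lower\<close>; a negative \<open>r\<close> is rounded to 0.\<close>
  define k where "k = nat \<lceil>r\<rceil> + length p"
  have k: "r \<le> real k - real (length p)" unfolding k_def by linarith
  obtain \<gamma> M c where \<gamma>: "\<gamma> \<in> geodesic_rays G p" "\<And>n. n \<ge> M \<Longrightarrow> \<gamma> n = ray x (n - M + c)"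
    using geodesic_ray_onto_ray[OF x(1)] by metis
  have "y \<in> {x \<in> \<Omega>. end_of x \<in> U}" if y: "y \<in> \<Omega>" "prefix_of k y = prefix_of k x" for y
  proof -
    obtain \<gamma>' M' c' where \<gamma>': "\<gamma>' \<in> geodesic_rays G p" "\<And>n. n \<ge> M' \<Longrightarrow> \<gamma>' n = ray y (n - M' + c')"
      using geodesic_ray_onto_ray[OF y(1)] by metis
    have "r \<le> gromov_product G p (\<gamma> n) (\<gamma>' n)" if "n \<ge> M + M' + k" for n
    proof -
      have n: "\<gamma> n = ray x (n - M + c)" "\<gamma>' n = ray y (n - M' + c')" "k \<le> n - M + c" "k \<le> n - M' + c'"
        using \<gamma>(2)[of n] \<gamma>'(2)[of n] that by auto
      have "ray y k = ray x k" using y(2) unfolding ray_def by simp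
      then have "take k (\<gamma> n) = take k (\<gamma>' n)" using n by (simp add: take_ray min_def)
      with n have "real k - real (length p) \<le> gromov_product G p (\<gamma> n) (\<gamma>' n)"
        by (intro gromov_product_lower geodesic_rayD(1)[OF \<gamma>(1)] geodesic_rayD(1)[OF \<gamma>'(1)]) auto
      with k show ?thesis by linarith
    qed
    then have "eventually (\<lambda>n. ereal r \<le> ereal (gromov_product G p (\<gamma> n) (\<gamma>' n))) sequentially"
      unfolding eventually_sequentially by auto
    then have "ereal r \<le> liminf (\<lambda>n. ereal (gromov_product G p (\<gamma> n) (\<gamma>' n)))" by (rule Liminf_bounded)
    then have "end_of y \<in> visual_nbhd G p (end_of x) r"
      unfolding visual_nbhd_def boundary_points_eq
      using y(1) end_ofI[OF \<gamma>(1) x(1) \<gamma>(2)] end_ofI[OF \<gamma>'(1) y(1) \<gamma>'(2)] by blast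
    with r y(1) show ?thesis by blast
  qed
  then show "\<exists>k. \<forall>y\<in>\<Omega>. prefix_of k y = prefix_of k x \<longrightarrow> y \<in> {x \<in> \<Omega>. end_of x \<in> U}" by blast
qed blast

text \<open>A compactness argument: the preimage of \<open>U\<close> contains a neighbourhood of the
  whole gluing class of \<open>x\<close> that is uniform in the level \<open>j\<close>. Otherwise
  counterexamples \<open>Y j\<close> accumulate at some \<open>y\<close>, which is glued to
  \<open>x\<close> because nearness passes to shorter prefixes; a cylinder around \<open>y\<close>
  inside the preimage then catches one of them.\<close>

lemma open_saturated:
  assumes U: "openin (cylinder_topology \<Omega>) {x \<in> \<Omega>. end_of x \<in> U}" and x: "x \<in> \<Omega>" "end_of x \<in> U"
  obtains j where "\<And>y. y \<in> \<Omega> \<Longrightarrow> (ray x j, ray y j) \<in> h ^^ 2 \<Longrightarrow> end_of y \<in> U"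
proof (rule ccontr)
  assume "\<not> thesis"
  with that have "\<forall>j. \<exists>y. y \<in> \<Omega> \<and> (ray x j, ray y j) \<in> h ^^ 2 \<and> end_of y \<notin> U" by blast
  then obtain Y where Y: "\<And>j. Y j \<in> \<Omega>" "\<And>j. (ray x j, ray (Y j) j) \<in> h ^^ 2" "\<And>j. end_of (Y j) \<notin> U"
    by metis
  have W: "prefix_of j (Y j) \<in> W" for j using Y(1)[of j] unfolding infinite_words_def by blast
  have fin: "finite {n. length (prefix_of n (Y n)) < k}" for k by simp
  have "\<exists>y\<in>\<Omega>. \<forall>k. infinite {n. take k (prefix_of n (Y n)) = prefix_of k y}"
    by (rule koenig_subsequence) (use W_prefix_closed W_finite W fin in blast)+
  then obtain y where y: "y \<in> \<Omega>" and inf: "\<And>k. infinite {n. take k (prefix_of n (Y n)) = prefix_of k y}"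
    by blast
  have approx: "\<exists>n\<ge>k. prefix_of k (Y n) = prefix_of k y" for k
  proof -
    obtain n where "n \<ge> k" "take k (prefix_of n (Y n)) = prefix_of k y"
      using inf[of k] unfolding infinite_nat_iff_unbounded_le by blast
    then show ?thesis by (intro exI[of _ n]) (simp add: take_map min_def)
  qed
  have "(ray x k, ray y k) \<in> h ^^ 2" for k
  proof -
    obtain n where n: "n \<ge> k" "prefix_of k (Y n) = prefix_of k y" using approx by blast
    have "(ray x k, ray (Y n) k) \<in> h ^^ 2" by (rule hpow_rays_mono[OF Y(2) n(1)])
    moreover have "ray (Y n) k = ray y k" using n(2) unfolding ray_def by simp
    ultimately show ?thesis by simp
  qed
  then have "end_of x = end_of y" using end_of_eq_iff[OF x(1) y] x(1) y unfolding glued_def by blast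
  with x y have "y \<in> {x \<in> \<Omega>. end_of x \<in> U}" by auto
  then obtain k where k: "\<forall>z\<in>\<Omega>. prefix_of k z = prefix_of k y \<longrightarrow> z \<in> {x \<in> \<Omega>. end_of x \<in> U}"
    using U unfolding openin_cylinder_topology by blast
  obtain n where "prefix_of k (Y n) = prefix_of k y" using approx by blast
  with k Y(1,3) show False by blast
qed

lemma open_image:
  assumes sub: "U \<subseteq> boundary_points G p"
    and U: "openin (cylinder_topology \<Omega>) {x \<in> \<Omega>. end_of x \<in> U}"
  shows "visual_open G p U"
  unfolding visual_open_def
proof (intro conjI ballI)
  fix \<xi> assume \<xi>: "\<xi> \<in> U"
  with sub obtain x where x: "x \<in> \<Omega>" "\<xi> = end_of x" unfolding boundary_points_eq by blast
  obtain j where j: "\<And>y. y \<in> \<Omega> \<Longrightarrow> (ray x j, ray y j) \<in> h ^^ 2 \<Longrightarrow> end_of y \<in> U"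
    using open_saturated[OF U x(1)] \<xi> x(2) by metis
  \<comment> \<open>Here the representatives are arbitrary members of their classes, so each is
    first compared with its vertical ray. The level \<open>j + 4\<close> allows for two uses of
    \<open>near_trans\<close>, which lose two levels each.\<close>
  have near_limit: "\<exists>N. \<forall>n\<ge>N. near (j + 4) (\<gamma> n) (ray z n)" if z: "z \<in> \<Omega>" and \<gamma>: "\<gamma> \<in> end_of z" for z \<gamma>
  proof -
    obtain K where ray: "\<gamma> \<in> geodesic_rays G p" and K: "\<And>n. d (\<gamma> n) (ray z n) \<le> K"
      using \<gamma> unfolding end_of_def by blast
    have "near (j + 4) (\<gamma> n) (ray z n)" if n: "n \<ge> K + j + length p + 7" for n
    proof -
      obtain k where k: "near k (\<gamma> n) (ray z n)"
        "length (\<gamma> n) + length (ray z n) \<le> d (\<gamma> n) (ray z n) + 2 * k + 6"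
        using near_exists[OF geodesic_rayD(1)[OF ray] ray_verts[OF z]] by blast
      have "j + 4 \<le> k" using k(2) K[of n] geodesic_ray_length(2)[OF ray, of n] n by simp
      with k(1) show ?thesis by (rule near_mono)
    qed
    then show ?thesis by blast
  qed
  \<comment> \<open>The radius is \<open>j + 4\<close> plus the loss \<open>length p + 3\<close> of
    \<open>gromov_product_upper\<close>, plus 1 because a lower bound on a limes inferior only
    yields eventual bounds by smaller numbers.\<close>
  have "visual_nbhd G p \<xi> (real (j + length p + 8)) \<subseteq> U"
  proof
    fix \<eta> assume "\<eta> \<in> visual_nbhd G p \<xi> (real (j + length p + 8))"
    then obtain y \<gamma> \<gamma>' where y: "y \<in> \<Omega>" "\<eta> = end_of y" and \<gamma>: "\<gamma> \<in> end_of x" "\<gamma>' \<in> end_of y"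
      and lim: "liminf (\<lambda>n. ereal (gromov_product G p (\<gamma> n) (\<gamma>' n))) \<ge> ereal (real (j + length p + 8))"
      unfolding visual_nbhd_def boundary_points_eq x(2) by blast
    have "ereal (real (j + length p + 7)) < ereal (real (j + length p + 8))" by simp
    from less_le_trans[OF this lim] obtain N1 where
      N1: "\<And>n. n \<ge> N1 \<Longrightarrow> real (j + length p + 7) < gromov_product G p (\<gamma> n) (\<gamma>' n)"
      using less_LiminfD[of _ sequentially] unfolding eventually_sequentially by (metis less_ereal.simps(1))
    obtain N2 where N2: "\<And>n. n \<ge> N2 \<Longrightarrow> near (j + 4) (\<gamma> n) (ray x n)" using near_limit[OF x(1) \<gamma>(1)] by blast
    obtain N3 where N3: "\<And>n. n \<ge> N3 \<Longrightarrow> near (j + 4) (\<gamma>' n) (ray y n)" using near_limit[OF y(1) \<gamma>(2)] by blast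
    define n where "n = max N1 (max N2 N3)"
    have V: "\<gamma> n \<in> verts G" "\<gamma>' n \<in> verts G" using \<gamma> geodesic_rayD(1) unfolding end_of_def by blast+
    obtain k where k: "near k (\<gamma> n) (\<gamma>' n)" "gromov_product G p (\<gamma> n) (\<gamma>' n) \<le> real k + real (length p) + 3"
      using gromov_product_upper[OF V] by blast
    have "real (j + 4) \<le> real k" using k(2) N1[of n] unfolding n_def by simp
    then have "j + 4 \<le> k" by (simp only: of_nat_le_iff)
    with k(1) have "near (j + 4) (\<gamma> n) (\<gamma>' n)" by (rule near_mono)
    moreover have "near (j + 4) (ray x n) (\<gamma> n)" "near (j + 4) (\<gamma>' n) (ray y n)"
      using near_sym[OF N2[of n]] N3[of n] unfolding n_def by simp_all
    ultimately have "near (j + 4 - 2) (ray x n) (\<gamma>' n)" "near (j + 4 - 2) (\<gamma>' n) (ray y n)"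
      using near_trans[of "j + 4" "ray x n" "\<gamma> n" "\<gamma>' n"] near_mono[of "j + 4" "\<gamma>' n" "ray y n" "j + 4 - 2"]
      by (simp_all only: diff_le_self)
    from near_trans[OF this] have "near j (ray x n) (ray y n)" by simp
    then have "(ray x j, ray y j) \<in> h ^^ 2" unfolding near_def take_ray length_ray by (metis min.absorb1)
    with j y show "\<eta> \<in> U" by blast
  qed
  then show "\<exists>r. visual_nbhd G p \<xi> r \<subseteq> U" by blast
qed (rule sub)

text \<open>\<open>end_of\<close> and the projection to gluing classes are quotient maps on the same
  space with the same fibres, so the induced bijection \<open>g\<close> is a homeomorphism.\<close>

theorem boundary_homeomorphic:
  "gromov_boundary G p homeomorphic_space quotient_topology (cylinder_topology \<Omega>) glued"
proof -
  let ?X = "cylinder_topology \<Omega>"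
  let ?Q = "quotient_topology ?X glued"
  have q: "quotient_map ?X (gromov_boundary G p) end_of"
    unfolding quotient_map_def topspace_cylinder_topology topspace_gromov_boundary openin_gromov_boundary
    using open_image open_preimage by (auto simp: boundary_points_eq)
  have cls: "glued `` {x} = {y \<in> \<Omega>. end_of y = end_of x}" if "x \<in> \<Omega>" for x
    using end_of_eq_iff[OF that] that unfolding glued_def by auto
  define g where "g c = end_of (SOME x. x \<in> c)" for c
  have g: "g (glued `` {x}) = end_of x" if "x \<in> \<Omega>" for x
  proof -
    have "(SOME y. y \<in> glued `` {x}) \<in> glued `` {x}" by (rule someI[of _ x]) (use that cls[OF that] in auto)
    with cls[OF that] show ?thesis unfolding g_def by auto
  qed
  have "quotient_map ?X (gromov_boundary G p) (g \<circ> (\<lambda>x. glued `` {x}))"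
    using quotient_map_eq[OF q] g by (simp add: topspace_cylinder_topology)
  then have "quotient_map ?Q (gromov_boundary G p) g"
    using quotient_map_compose_eq[OF quotient_map_quotient_topology] by blast
  moreover have "inj_on g (topspace ?Q)"
    unfolding topspace_quotient_topology topspace_cylinder_topology
  proof (rule inj_onI)
    fix a b assume "a \<in> \<Omega> // glued" "b \<in> \<Omega> // glued" "g a = g b"
    then obtain x y where "x \<in> \<Omega>" "y \<in> \<Omega>" "a = glued `` {x}" "b = glued `` {y}" "end_of x = end_of y"
      using g by (auto elim!: quotientE)
    then show "a = b" using cls by simp
  qed
  ultimately have "homeomorphic_map ?Q (gromov_boundary G p) g" unfolding homeomorphic_map_def by blast
  then have "?Q homeomorphic_space gromov_boundary G p" by (rule homeomorphic_map_imp_homeomorphic_space)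
  then show ?thesis by (rule iffD1[OF homeomorphic_space_sym])
qed

end

end

section \<open>Levels of the history graph\<close>

definition edge_word :: "('c, 'e) eword \<Rightarrow> ('c, 'v, 'e) letter list" where
  "edge_word w = map (\<lambda>(i, e). EdgeL i e) w"

text \<open>The index of the graph that supplies the next letter, read off from the word alone. A
  vertex \<open>(w, v)\<close> survives in all later expansions, whereas
  \<open>col (full_expansion S m) w\<close> is meaningful only for the one \<open>m\<close> at which
  \<open>w\<close> is an edge.\<close>

definition last_index :: "('c, 'v, 'e) ers \<Rightarrow> ('c, 'e) eword \<Rightarrow> 'c option" where
  "last_index S w = (if w = [] then None else Some (col (graph_of S (fst (last w))) (snd (last w))))"

text \<open>The word at level \<open>n + 1\<close> that stands for a vertex of \<open>full_expansion S n\<close>.\<close>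

definition vertex_word ::
  "('c, 'v, 'e) ers \<Rightarrow> nat \<Rightarrow> ('c, 'e) eword \<times> 'v \<Rightarrow> ('c, 'v, 'e) letter list" where
  "vertex_word S n z = edge_word (fst z) @
     VertL (last_index S (fst z)) (snd z) # replicate (n - length (fst z)) LoopV"

lemma edge_word_simps [simp]:
  "edge_word [] = []" "edge_word (w @ [(i, e)]) = edge_word w @ [EdgeL i e]"
  "length (edge_word w) = length w" "edge_word [(i, e)] = [EdgeL i e]"
  by (simp_all add: edge_word_def)

lemma inj_edge_letter: "inj (\<lambda>(i, e). EdgeL i e)"
  by (auto simp: inj_def)

lemma edge_word_inject [simp]: "edge_word w = edge_word w' \<longleftrightarrow> w = w'"
  unfolding edge_word_def by (rule inj_map_eq_map[OF inj_edge_letter])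

lemma butlast_edge_word: "butlast (edge_word w) = edge_word (butlast w)"
  by (simp add: edge_word_def map_butlast)

lemma takeWhile_edge_word:
  "takeWhile (\<lambda>l. \<exists>i e. l = EdgeL i e) (edge_word w @ VertL j v # us) = edge_word w"
  by (subst takeWhile_append2) (auto simp: edge_word_def)

text \<open>The letter \<open>VertL\<close> marks the end of the edge word, so the pair can be
  recovered from its word.\<close>

lemma vertex_word_inject: "vertex_word S n z = vertex_word S n z' \<longleftrightarrow> z = z'"
proof
  assume eq: "vertex_word S n z = vertex_word S n z'"
  from arg_cong[OF eq, of "takeWhile (\<lambda>l. \<exists>i e. l = EdgeL i e)"]
  have "fst z = fst z'" unfolding vertex_word_def takeWhile_edge_word by simp
  with eq show "z = z'" unfolding vertex_word_def by (simp add: prod_eq_iff)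
qed simp

lemma edge_word_neq_vertex_word: "edge_word w \<noteq> vertex_word S n z"
proof
  assume "edge_word w = vertex_word S n z"
  then have "VertL (last_index S (fst z)) (snd z) \<in> set (edge_word w :: ('a, 'b, 'c) letter list)"
    by (simp add: vertex_word_def)
  then show False by (auto simp: edge_word_def)
qed

text \<open>The names of the arcs are forgotten: \<open>next_level\<close> computes ends and colors
  from ends and colors, and distances depend on the ends only. The lists that name arcs of a level
  thus never have to be matched with edges of an expansion.\<close>

definition triples :: "('v, 'e, 'c) cgraph \<Rightarrow> ('v \<times> 'v \<times> 'c) set" where
  "triples Y = (\<lambda>a. (ctail Y a, chead Y a, col Y a)) ` carcs Y"

definition place_at :: "'l list \<Rightarrow> 'l list \<Rightarrow> side \<times> 'l \<Rightarrow> 'l list" where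
  "place_at t h q = (case fst q of Ini \<Rightarrow> t | Ter \<Rightarrow> h) @ [snd q]"

lemma place_eq: "place Y a q = place_at (ctail Y a) (chead Y a) q"
  unfolding place_def place_at_def by (auto split: prod.splits side.splits)

lemma triples_next_level:
  "(t', h', k') \<in> triples (next_level V Y) \<longleftrightarrow>
    (\<exists>t h k. (t, h, k) \<in> triples Y \<and> (\<exists>r\<in>carcs (vrepl V k).
      t' = place_at t h (ctail (vrepl V k) r) \<and> h' = place_at t h (chead (vrepl V k) r) \<and>
      k' = col (vrepl V k) r))" (is "?L \<longleftrightarrow> ?R")
proof
  assume ?L
  then obtain a r where a: "a \<in> carcs Y" "r \<in> carcs (vrepl V (col Y a))"
    "t' = place_at (ctail Y a) (chead Y a) (ctail (vrepl V (col Y a)) r)"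
    "h' = place_at (ctail Y a) (chead Y a) (chead (vrepl V (col Y a)) r)"
    "k' = col (vrepl V (col Y a)) r"
    unfolding triples_def next_level_def by (auto simp: Let_def place_eq)
  then show ?R unfolding triples_def by blast
next
  assume ?R
  then obtain a r where a: "a \<in> carcs Y" "r \<in> carcs (vrepl V (col Y a))"
    "t' = place_at (ctail Y a) (chead Y a) (ctail (vrepl V (col Y a)) r)"
    "h' = place_at (ctail Y a) (chead Y a) (chead (vrepl V (col Y a)) r)"
    "k' = col (vrepl V (col Y a)) r"
    unfolding triples_def by auto
  then show ?L unfolding triples_def next_level_def
    by (auto simp: Let_def place_eq intro!: image_eqI[of _ _ "a @ [r]"])
qed

locale expanding_ers =
  fixes S :: "('c, 'v, 'e) ers" and BI BT :: "'c \<Rightarrow> ('v + 'e, 'e half) pre_digraph"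
  assumes ers: "is_ers S" and expanding: "expanding S" and partition: "admissible_partition S BI BT"
begin

abbreviation F where "F \<equiv> full_expansion S"
abbreviation X where "X \<equiv> graph_of S"
abbreviation V where "V \<equiv> vers_of S BI BT"
abbreviation \<Sigma> where "\<Sigma> \<equiv> ers_type_graph S"
abbreviation H where "H \<equiv> history_graph V"
abbreviation vword where "vword \<equiv> vertex_word S"

lemma Some_indices [simp]: "Some c \<in> indices S \<longleftrightarrow> c \<in> colors S"
  and None_indices [simp]: "None \<in> indices S"
  by (auto simp: indices_def)

lemma graph_facts:
  assumes "i \<in> indices S"
  shows "finite (carcs (X i))" "e \<in> carcs (X i) \<Longrightarrow> ctail (X i) e \<in> cverts (X i)"
    "e \<in> carcs (X i) \<Longrightarrow> chead (X i) e \<in> cverts (X i)"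
    "e \<in> carcs (X i) \<Longrightarrow> col (X i) e \<in> colors S"
    "v \<in> cverts (X i) \<Longrightarrow> \<exists>e\<in>carcs (X i). v = ctail (X i) e \<or> v = chead (X i) e"
proof -
  interpret fin_digraph "dig (X i)" using ers assms unfolding is_ers_def by blast
  show "finite (carcs (X i))" "e \<in> carcs (X i) \<Longrightarrow> ctail (X i) e \<in> cverts (X i)"
    "e \<in> carcs (X i) \<Longrightarrow> chead (X i) e \<in> cverts (X i)" by auto
  show "e \<in> carcs (X i) \<Longrightarrow> col (X i) e \<in> colors S" using ers assms unfolding is_ers_def by blast
  show "v \<in> cverts (X i) \<Longrightarrow> \<exists>e\<in>carcs (X i). v = ctail (X i) e \<or> v = chead (X i) e"
    using expanding assms unfolding expanding_def by blast
qed

lemma iota_tau: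
  assumes "c \<in> colors S"
  shows "iota_v S c \<in> cverts (X (Some c))" "tau_v S c \<in> cverts (X (Some c))" "iota_v S c \<noteq> tau_v S c"
    "e \<in> carcs (X (Some c)) \<Longrightarrow>
      {ctail (X (Some c)) e, chead (X (Some c)) e} \<noteq> {iota_v S c, tau_v S c}"
  using ers expanding assms unfolding is_ers_def expanding_def by blast+

section \<open>Arcs and vertices of the expansion sequence\<close>

lemma arcs_F0: "carcs (F 0) = {[(None, e)] |e. e \<in> carcs (X None)}"
  and verts_F0: "cverts (F 0) = {([], v) |v. v \<in> cverts (X None)}"
  and ends_F0: "ctail (F 0) [(None, e)] = ([], ctail (X None) e)"
    "chead (F 0) [(None, e)] = ([], chead (X None) e)"
  and col_F0: "col (F 0) [(None, e)] = col (X None) e"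
  by (auto simp: base_expansion_def Let_def)

lemma arcs_FSuc: "carcs (F (Suc n)) =
    {w @ [(Some (col (F n) w), e)] |w e. w \<in> carcs (F n) \<and> e \<in> carcs (X (Some (col (F n) w)))}"
  and verts_FSuc: "cverts (F (Suc n)) =
    cverts (F n) \<union> {(w, v) |w v. w \<in> carcs (F n) \<and> v \<in> inner_verts S (col (F n) w)}"
  and ends_FSuc: "ctail (F (Suc n)) (w @ [(i, e)]) = glue S (F n) w (ctail (X (Some (col (F n) w))) e)"
    "chead (F (Suc n)) (w @ [(i, e)]) = glue S (F n) w (chead (X (Some (col (F n) w))) e)"
  and col_FSuc: "col (F (Suc n)) (w @ [(i, e)]) = col (X (Some (col (F n) w))) e"
  by (auto simp: expand_def Let_def)

lemma F_arc: "w \<in> carcs (F n) \<Longrightarrow>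
    length w = Suc n \<and> last_index S w = Some (col (F n) w) \<and> col (F n) w \<in> colors S"
proof (induction n arbitrary: w)
  case 0
  then obtain e where "w = [(None, e)]" "e \<in> carcs (X None)" unfolding arcs_F0 by blast
  then show ?case using graph_facts(4)[of None e] by (simp add: col_F0 last_index_def del: full_expansion.simps)
next
  case (Suc n)
  then obtain u e where w: "w = u @ [(Some (col (F n) u), e)]" "u \<in> carcs (F n)"
    "e \<in> carcs (X (Some (col (F n) u)))" unfolding arcs_FSuc by blast
  with Suc.IH[OF w(2)] graph_facts(4)[of "Some (col (F n) u)" e] show ?case
    by (simp add: col_FSuc last_index_def del: full_expansion.simps)
qed

lemma glue_simps:
  assumes "w \<in> carcs (F n)"
  shows "glue S (F n) w (iota_v S (col (F n) w)) = ctail (F n) w"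
    "glue S (F n) w (tau_v S (col (F n) w)) = chead (F n) w"
    "v \<in> inner_verts S (col (F n) w) \<Longrightarrow> glue S (F n) w v = (w, v)"
proof -
  have "col (F n) w \<in> colors S" using F_arc assms by blast
  from iota_tau(3)[OF this] show "glue S (F n) w (iota_v S (col (F n) w)) = ctail (F n) w"
    "glue S (F n) w (tau_v S (col (F n) w)) = chead (F n) w"
    "v \<in> inner_verts S (col (F n) w) \<Longrightarrow> glue S (F n) w v = (w, v)"
    by (auto simp: glue_def inner_verts_def)
qed

lemma F_ends: "w \<in> carcs (F n) \<Longrightarrow> ctail (F n) w \<in> cverts (F n) \<and> chead (F n) w \<in> cverts (F n)"
proof (induction n arbitrary: w)
  case 0
  then obtain e where "w = [(None, e)]" "e \<in> carcs (X None)" unfolding arcs_F0 by blast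
  then show ?case using graph_facts(2,3)[of None e]
    by (simp add: ends_F0 verts_F0 del: full_expansion.simps)
next
  case (Suc n)
  then obtain u e where w: "w = u @ [(Some (col (F n) u), e)]" "u \<in> carcs (F n)"
    "e \<in> carcs (X (Some (col (F n) u)))" unfolding arcs_FSuc by blast
  have "glue S (F n) u v \<in> cverts (F (Suc n))" if "v \<in> cverts (X (Some (col (F n) u)))" for v
    using that Suc.IH[OF w(2)] w(2) unfolding verts_FSuc glue_def inner_verts_def by auto
  moreover have "ctail (X (Some (col (F n) u))) e \<in> cverts (X (Some (col (F n) u)))"
      "chead (X (Some (col (F n) u))) e \<in> cverts (X (Some (col (F n) u)))"
    using graph_facts(2,3)[OF _ w(3)] F_arc[OF w(2)] by auto
  ultimately show ?case unfolding w(1) ends_FSuc by blast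
qed

lemma F_finite: "finite (carcs (F n))"
proof (induction n)
  case 0
  have "carcs (F 0) = (\<lambda>e. [(None, e)]) ` carcs (X None)" unfolding arcs_F0 by blast
  then show ?case using graph_facts(1)[of None] by simp
next
  case (Suc n)
  have "carcs (F (Suc n)) = (\<Union>w\<in>carcs (F n). (\<lambda>e. w @ [(Some (col (F n) w), e)]) ` carcs (X (Some (col (F n) w))))"
    unfolding arcs_FSuc by blast
  moreover have "finite (carcs (X (Some (col (F n) w))))" if "w \<in> carcs (F n)" for w
    using graph_facts(1) F_arc[OF that] by simp
  ultimately show ?case using Suc by (simp del: full_expansion.simps)
qed

lemma F_vert_length: "(w, v) \<in> cverts (F n) \<Longrightarrow> length w \<le> n"
proof (induction n)
  case 0
  then show ?case unfolding verts_F0 by blast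
next
  case (Suc n)
  then show ?case using F_arc[of w n] unfolding verts_FSuc by auto
qed

text \<open>An old vertex is an end of some old edge \<open>w\<close>, hence the image under
  \<open>glue\<close> of a distinguished vertex of the graph replacing \<open>w\<close>, and that
  vertex is not isolated there.\<close>

lemma F_not_isolated: "z \<in> cverts (F n) \<Longrightarrow> \<exists>w\<in>carcs (F n). z = ctail (F n) w \<or> z = chead (F n) w"
proof (induction n arbitrary: z)
  case 0
  then obtain v where v: "z = ([], v)" "v \<in> cverts (X None)" unfolding verts_F0 by blast
  then obtain e where "e \<in> carcs (X None)" "v = ctail (X None) e \<or> v = chead (X None) e"
    using graph_facts(5)[of None v] by auto
  then show ?case unfolding v(1) using arcs_F0 ends_F0[of e] by (metis (mono_tags, lifting) mem_Collect_eq)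
next
  case (Suc n)
  have "\<exists>u\<in>carcs (F (Suc n)). glue S (F n) w v = ctail (F (Suc n)) u \<or> glue S (F n) w v = chead (F (Suc n)) u"
    if w: "w \<in> carcs (F n)" and v: "v \<in> cverts (X (Some (col (F n) w)))" for w v
  proof -
    let ?c = "Some (col (F n) w)"
    obtain e where e: "e \<in> carcs (X ?c)" "v = ctail (X ?c) e \<or> v = chead (X ?c) e"
      using graph_facts(5)[OF _ v] F_arc[OF w] by auto
    have "w @ [(?c, e)] \<in> carcs (F (Suc n))" unfolding arcs_FSuc using w e(1) by blast
    then show ?thesis using e(2) ends_FSuc[of n w ?c e] by metis
  qed note glued = this
  from Suc.prems consider "z \<in> cverts (F n)" | w v where "z = (w, v)" "w \<in> carcs (F n)" "v \<in> inner_verts S (col (F n) w)"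
    unfolding verts_FSuc by blast
  then show ?case
  proof cases
    case 1
    then obtain w where w: "w \<in> carcs (F n)" "z = ctail (F n) w \<or> z = chead (F n) w" using Suc.IH by blast
    have "col (F n) w \<in> colors S" using F_arc w(1) by blast
    then show ?thesis using glued[OF w(1) iota_tau(1)] glued[OF w(1) iota_tau(2)] glue_simps[OF w(1)] w(2) by auto
  next
    case 2
    then show ?thesis using glued[OF 2(2), of v] glue_simps(3)[OF 2(2,3)] unfolding inner_verts_def by auto
  qed
qed

lemma length_vword: "z \<in> cverts (F n) \<Longrightarrow> length (vword n z) = Suc n"
  using F_vert_length[of "fst z" "snd z" n] by (simp add: vertex_word_def)

lemma vword_Suc_old: "z \<in> cverts (F n) \<Longrightarrow> vword (Suc n) z = vword n z @ [LoopV]"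
  using F_vert_length[of "fst z" "snd z" n]
  by (simp add: vertex_word_def Suc_diff_le replicate_append_same)

lemma vword_Suc_new: "w \<in> carcs (F n) \<Longrightarrow> vword (Suc n) (w, v) = edge_word w @ [VertL (Some (col (F n) w)) v]"
  using F_arc[of w n] by (simp add: vertex_word_def)

subsection \<open>The history graph consists of barycentric subdivisions\<close>

text \<open>The word of the vertex \<open>z\<close> of the copy of a barycentric subdivision replacing the edge \<open>w\<close>.\<close>

definition copy_word where
  "copy_word n w z = (case z of Inl v \<Rightarrow> vword (Suc n) (glue S (F n) w v)
     | Inr e \<Rightarrow> edge_word (w @ [(Some (col (F n) w), e)]))"

lemma vword_glue:
  assumes "w \<in> carcs (F n)"
  shows "vword (Suc n) (glue S (F n) w v) =
    (if v = iota_v S (col (F n) w) then vword n (ctail (F n) w) @ [LoopV]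
     else if v = tau_v S (col (F n) w) then vword n (chead (F n) w) @ [LoopV]
     else edge_word w @ [VertL (Some (col (F n) w)) v])"
  using F_ends[OF assms] vword_Suc_old[of _ n] vword_Suc_new[OF assms] unfolding glue_def by auto

text \<open>The first half of \<open>w\<close> leads from the word of its tail to the edge word. The
  letter \<open>LoopV\<close> on the initial side prolongs the word of the tail, which persists as a
  vertex, and all other letters prolong the edge word. The excluded \<open>tau_v\<close> would be
  attached to the edge word although it is the head of \<open>w\<close>.\<close>

lemma place_ren_iota:
  assumes "w \<in> carcs (F n)" "z \<noteq> Inl (tau_v S (col (F n) w))"
  shows "place_at (vword n (ctail (F n) w)) (edge_word w) (ren_iota S (col (F n) w) z) = copy_word n w z"
  using assms(2) unfolding ren_iota_def place_at_def copy_word_def bar_letter_def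
  by (auto simp: vword_glue[OF assms(1)] split: sum.splits)

text \<open>The second half of \<open>w\<close> leads from the edge word to the word of the head, so
  the initial and terminal sides change roles.\<close>

lemma place_ren_tau:
  assumes "w \<in> carcs (F n)" "z \<noteq> Inl (iota_v S (col (F n) w))"
  shows "place_at (edge_word w) (vword n (chead (F n) w)) (ren_tau S (col (F n) w) z) = copy_word n w z"
  using assms(2) iota_tau(3) F_arc[OF assms(1)] unfolding ren_tau_def place_at_def copy_word_def bar_letter_def
  by (auto simp: vword_glue[OF assms(1)] split: sum.splits)

lemma partition_facts:
  assumes "c \<in> colors S"
  shows "tail (BI c) = ctail (bar (X (Some c)))" "head (BI c) = chead (bar (X (Some c)))"
    "tail (BT c) = ctail (bar (X (Some c)))" "head (BT c) = chead (bar (X (Some c)))"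
    "arcs (BI c) \<union> arcs (BT c) = carcs (bar (X (Some c)))"
    "r \<in> arcs (BI c) \<Longrightarrow> tail (BI c) r \<noteq> Inl (tau_v S c) \<and> head (BI c) r \<noteq> Inl (tau_v S c)"
    "r \<in> arcs (BT c) \<Longrightarrow> tail (BT c) r \<noteq> Inl (iota_v S c) \<and> head (BT c) r \<noteq> Inl (iota_v S c)"
proof -
  from partition assms have p: "subgraph (BI c) (dig (bar (X (Some c))))"
    "subgraph (BT c) (dig (bar (X (Some c))))"
    "arcs (BI c) \<union> arcs (BT c) = carcs (bar (X (Some c)))"
    "Inl (tau_v S c) \<notin> verts (BI c)" "Inl (iota_v S c) \<notin> verts (BT c)"
    unfolding admissible_partition_def Let_def by auto
  interpret I: wf_digraph "BI c" using p(1) unfolding subgraph_def by blast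
  interpret T: wf_digraph "BT c" using p(2) unfolding subgraph_def by blast
  show "tail (BI c) = ctail (bar (X (Some c)))" "head (BI c) = chead (bar (X (Some c)))"
    "tail (BT c) = ctail (bar (X (Some c)))" "head (BT c) = chead (bar (X (Some c)))"
    using p(1,2) unfolding subgraph_def compatible_def by auto
  show "arcs (BI c) \<union> arcs (BT c) = carcs (bar (X (Some c)))" by (rule p(3))
  show "r \<in> arcs (BI c) \<Longrightarrow> tail (BI c) r \<noteq> Inl (tau_v S c) \<and> head (BI c) r \<noteq> Inl (tau_v S c)"
    using p(4) I.tail_in_verts I.head_in_verts by metis
  show "r \<in> arcs (BT c) \<Longrightarrow> tail (BT c) r \<noteq> Inl (iota_v S c) \<and> head (BT c) r \<noteq> Inl (iota_v S c)"
    using p(5) T.tail_in_verts T.head_in_verts by metis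
qed

text \<open>These are the arcs of the barycentric subdivision of \<open>F n\<close> in the form of
  \<open>triples\<close>, with each vertex of the subdivision written as its word of length
  \<open>n + 1\<close>.\<close>

definition half_edges where
  "half_edges n = (\<lambda>w. (vword n (ctail (F n) w), edge_word w, CI (col (F n) w))) ` carcs (F n) \<union>
     (\<lambda>w. (edge_word w, vword n (chead (F n) w), CT (col (F n) w))) ` carcs (F n)"

lemma bar_simps:
  "carcs (bar Y) = IHalf ` carcs Y \<union> THalf ` carcs Y"
  "ctail (bar Y) (IHalf e) = Inl (ctail Y e)" "ctail (bar Y) (THalf e) = Inr e"
  "chead (bar Y) (IHalf e) = Inr e" "chead (bar Y) (THalf e) = Inl (chead Y e)"
  "col (bar Y) (IHalf e) = CI (col Y e)" "col (bar Y) (THalf e) = CT (col Y e)"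
  by (simp_all add: bar_def)

text \<open>Subdivision commutes with expansion: the halves of the edges in the copy substituted for
  \<open>w\<close> are the arcs of the subdivided replacement graph.\<close>

lemma half_edges_Suc:
  "half_edges (Suc n) = {(copy_word n w (ctail (bar (X c)) r), copy_word n w (chead (bar (X c)) r), col (bar (X c)) r)
     |w c r. w \<in> carcs (F n) \<and> c = Some (col (F n) w) \<and> r \<in> carcs (bar (X c))}" (is "_ = ?R")
proof -
  have 1: "(vword (Suc n) (ctail (F (Suc n)) u), edge_word u, CI (col (F (Suc n)) u)) =
      (copy_word n w (ctail (bar (X c)) (IHalf e)), copy_word n w (chead (bar (X c)) (IHalf e)), col (bar (X c)) (IHalf e))"
      "(edge_word u, vword (Suc n) (chead (F (Suc n)) u), CT (col (F (Suc n)) u)) =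
      (copy_word n w (ctail (bar (X c)) (THalf e)), copy_word n w (chead (bar (X c)) (THalf e)), col (bar (X c)) (THalf e))"
    if "c = Some (col (F n) w)" "u = w @ [(c, e)]" for w c e u
    using that by (simp_all add: bar_simps copy_word_def ends_FSuc col_FSuc del: full_expansion.simps)
  show ?thesis
  proof (intro set_eqI iffI)
    fix q assume "q \<in> half_edges (Suc n)"
    then obtain u where u: "u \<in> carcs (F (Suc n))" and q: "q = (vword (Suc n) (ctail (F (Suc n)) u), edge_word u, CI (col (F (Suc n)) u))
      \<or> q = (edge_word u, vword (Suc n) (chead (F (Suc n)) u), CT (col (F (Suc n)) u))"
      unfolding half_edges_def by blast
    from u obtain w e where w: "w \<in> carcs (F n)" "e \<in> carcs (X (Some (col (F n) w)))"
      "u = w @ [(Some (col (F n) w), e)]" unfolding arcs_FSuc by blast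
    then have "IHalf e \<in> carcs (bar (X (Some (col (F n) w))))" "THalf e \<in> carcs (bar (X (Some (col (F n) w))))"
      unfolding bar_simps by auto
    with w(1) q show "q \<in> ?R" unfolding 1[OF refl w(3)] by blast
  next
    fix q assume "q \<in> ?R"
    then obtain w c r where w: "w \<in> carcs (F n)" "c = Some (col (F n) w)" "r \<in> carcs (bar (X c))"
      and q: "q = (copy_word n w (ctail (bar (X c)) r), copy_word n w (chead (bar (X c)) r), col (bar (X c)) r)" by blast
    from w(3) obtain e where e: "e \<in> carcs (X c)" "r = IHalf e \<or> r = THalf e" unfolding bar_simps by blast
    let ?u = "w @ [(c, e)]"
    have "?u \<in> carcs (F (Suc n))" unfolding arcs_FSuc using w e(1) by blast
    then have "(vword (Suc n) (ctail (F (Suc n)) ?u), edge_word ?u, CI (col (F (Suc n)) ?u)) \<in> half_edges (Suc n)"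
      "(edge_word ?u, vword (Suc n) (chead (F (Suc n)) ?u), CT (col (F (Suc n)) ?u)) \<in> half_edges (Suc n)"
      unfolding half_edges_def by blast+
    with e(2) show "q \<in> half_edges (Suc n)"
      unfolding q 1[OF w(2) refl, of e] by (elim disjE) (simp_all only:)
  qed
qed

text \<open>The \<open>CI\<close> half of an edge is replaced by the part \<open>BI\<close> of the
  subdivided replacement graph and the \<open>CT\<close> half by \<open>BT\<close>. Both parts are
  placed by the same map \<open>copy_word\<close>, so together they give the whole copy, whichever
  partition was chosen. The index shift comes from level 0, which is the root with its loop.\<close>

lemma level_triples: "triples (level V (Suc n)) = half_edges n"
proof (induction n)
  case 0
  have base: "triples (level V 0) = {([], [], C0)}"
    by (simp add: triples_def base_level_def vers_of_def)
  have "(t, h, k) \<in> triples (level V (Suc 0)) \<longleftrightarrow> (t, h, k) \<in> half_edges 0" for t h k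
  proof -
    have "(t, h, k) \<in> triples (level V (Suc 0)) \<longleftrightarrow> (\<exists>r\<in>carcs (bar (X None)).
        t = [bar_letter None (ctail (bar (X None)) r)] \<and> h = [bar_letter None (chead (bar (X None)) r)] \<and>
        k = col (bar (X None)) r)"
      unfolding level.simps(2) triples_next_level base
      by (auto simp: vers_of_def ers_vrepl_def Let_def place_at_def)
    also have "\<dots> \<longleftrightarrow> (t, h, k) \<in> half_edges 0"
      unfolding half_edges_def arcs_F0 Setcompr_eq_image image_image bar_simps(1)
      by (simp add: bar_simps(2-) ends_F0 col_F0 bar_letter_def vertex_word_def last_index_def bex_Un image_iff
        del: full_expansion.simps)
    finally show ?thesis .
  qed
  then show ?case by (intro set_eqI) auto
next
  case (Suc n)
  have I: "(\<exists>r\<in>carcs (vrepl V (CI (col (F n) w))).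
      t' = place_at (vword n (ctail (F n) w)) (edge_word w) (ctail (vrepl V (CI (col (F n) w))) r) \<and>
      h' = place_at (vword n (ctail (F n) w)) (edge_word w) (chead (vrepl V (CI (col (F n) w))) r) \<and>
      k' = col (vrepl V (CI (col (F n) w))) r) \<longleftrightarrow>
      (\<exists>r\<in>arcs (BI (col (F n) w)). t' = copy_word n w (ctail (bar (X (Some (col (F n) w)))) r) \<and>
        h' = copy_word n w (chead (bar (X (Some (col (F n) w)))) r) \<and> k' = col (bar (X (Some (col (F n) w)))) r)"
    if w: "w \<in> carcs (F n)" for w t' h' k'
  proof -
    have c: "col (F n) w \<in> colors S" using F_arc[OF w] by blast
    show ?thesis
      unfolding vers_of_def ers_vrepl_def
      using partition_facts(1,2,6)[OF c] place_ren_iota[OF w] by auto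
  qed
  have T: "(\<exists>r\<in>carcs (vrepl V (CT (col (F n) w))).
      t' = place_at (edge_word w) (vword n (chead (F n) w)) (ctail (vrepl V (CT (col (F n) w))) r) \<and>
      h' = place_at (edge_word w) (vword n (chead (F n) w)) (chead (vrepl V (CT (col (F n) w))) r) \<and>
      k' = col (vrepl V (CT (col (F n) w))) r) \<longleftrightarrow>
      (\<exists>r\<in>arcs (BT (col (F n) w)). t' = copy_word n w (ctail (bar (X (Some (col (F n) w)))) r) \<and>
        h' = copy_word n w (chead (bar (X (Some (col (F n) w)))) r) \<and> k' = col (bar (X (Some (col (F n) w)))) r)"
    if w: "w \<in> carcs (F n)" for w t' h' k'
  proof -
    have c: "col (F n) w \<in> colors S" using F_arc[OF w] by blast
    show ?thesis
      unfolding vers_of_def ers_vrepl_def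
      using partition_facts(3,4,7)[OF c] place_ren_tau[OF w] by auto
  qed
  have "(t', h', k') \<in> triples (level V (Suc (Suc n))) \<longleftrightarrow> (t', h', k') \<in> half_edges (Suc n)" for t' h' k'
  proof -
    let ?P = "\<lambda>w r. t' = copy_word n w (ctail (bar (X (Some (col (F n) w)))) r) \<and>
        h' = copy_word n w (chead (bar (X (Some (col (F n) w)))) r) \<and> k' = col (bar (X (Some (col (F n) w)))) r"
    have "(t', h', k') \<in> triples (level V (Suc (Suc n))) \<longleftrightarrow>
        (\<exists>t h k. (t, h, k) \<in> half_edges n \<and> (\<exists>r\<in>carcs (vrepl V k).
          t' = place_at t h (ctail (vrepl V k) r) \<and> h' = place_at t h (chead (vrepl V k) r) \<and>
          k' = col (vrepl V k) r))"
      unfolding level.simps(2)[of V "Suc n"] triples_next_level Suc.IH ..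
    also have "\<dots> \<longleftrightarrow> (\<exists>w\<in>carcs (F n). (\<exists>r\<in>arcs (BI (col (F n) w)). ?P w r) \<or> (\<exists>r\<in>arcs (BT (col (F n) w)). ?P w r))"
      (is "?L = ?R")
    proof
      assume ?L
      then obtain t h k where thk: "(t, h, k) \<in> half_edges n" and ex: "\<exists>r\<in>carcs (vrepl V k).
          t' = place_at t h (ctail (vrepl V k) r) \<and> h' = place_at t h (chead (vrepl V k) r) \<and>
          k' = col (vrepl V k) r" by blast
      from thk obtain w where w: "w \<in> carcs (F n)" and
        "(t, h, k) = (vword n (ctail (F n) w), edge_word w, CI (col (F n) w)) \<or>
         (t, h, k) = (edge_word w, vword n (chead (F n) w), CT (col (F n) w))"
        unfolding half_edges_def by blast
      then show ?R using ex I[OF w] T[OF w] by (elim disjE) auto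
    next
      assume ?R
      then obtain w where w: "w \<in> carcs (F n)"
        and "(\<exists>r\<in>arcs (BI (col (F n) w)). ?P w r) \<or> (\<exists>r\<in>arcs (BT (col (F n) w)). ?P w r)" by blast
      moreover have "(vword n (ctail (F n) w), edge_word w, CI (col (F n) w)) \<in> half_edges n"
        "(edge_word w, vword n (chead (F n) w), CT (col (F n) w)) \<in> half_edges n"
        using w unfolding half_edges_def by blast+
      ultimately show ?L unfolding I[OF w, symmetric] T[OF w, symmetric] by blast
    qed
    also have "\<dots> \<longleftrightarrow> (\<exists>w\<in>carcs (F n). \<exists>r\<in>carcs (bar (X (Some (col (F n) w)))). ?P w r)"
    proof -
      have "(\<exists>r\<in>arcs (BI (col (F n) w)). ?P w r) \<or> (\<exists>r\<in>arcs (BT (col (F n) w)). ?P w r) \<longleftrightarrow>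
          (\<exists>r\<in>carcs (bar (X (Some (col (F n) w)))). ?P w r)" if "w \<in> carcs (F n)" for w
      proof -
        have "col (F n) w \<in> colors S" using F_arc[OF that] by blast
        from partition_facts(5)[OF this, symmetric] show ?thesis by (simp only: bex_Un)
      qed
      then show ?thesis by blast
    qed
    also have "\<dots> \<longleftrightarrow> (t', h', k') \<in> half_edges (Suc n)"
      unfolding half_edges_Suc by blast
    finally show ?thesis .
  qed
  then show ?case by (intro set_eqI) auto
qed

end

lemma ex_nat_Suc: "(\<exists>n. P n) \<longleftrightarrow> P 0 \<or> (\<exists>n. P (Suc n))"
  by (metis not0_implies_Suc)

lemma all_nat_Suc: "(\<forall>n. P n) \<longleftrightarrow> P 0 \<and> (\<forall>n. P (Suc n))"
  by (metis not0_implies_Suc)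

context expanding_ers
begin

section \<open>Horizontal adjacency in the history graph and its contraction\<close>

definition horizontal :: "('c, 'v, 'e) letter list rel" where
  "horizontal = {(u, v). \<exists>n a. a \<in> carcs (level V n) \<and>
    ((u, v) = (ctail (level V n) a, chead (level V n) a) \<or> (v, u) = (ctail (level V n) a, chead (level V n) a))}"

abbreviation near_eq where "near_eq \<equiv> horizontal\<^sup>="

definition ends where "ends n w = {ctail (F n) w, chead (F n) w}"

lemma level_ends: "(\<exists>a\<in>carcs (level V (Suc n)). (u, v) = (ctail (level V (Suc n)) a, chead (level V (Suc n)) a)) \<longleftrightarrow>
    (\<exists>w\<in>carcs (F n). (u, v) = (vword n (ctail (F n) w), edge_word w) \<or> (u, v) = (edge_word w, vword n (chead (F n) w)))"
proof -
  have "(\<exists>a\<in>carcs (level V (Suc n)). (u, v) = (ctail (level V (Suc n)) a, chead (level V (Suc n)) a)) \<longleftrightarrow>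
      (\<exists>k. (u, v, k) \<in> triples (level V (Suc n)))" unfolding triples_def by (auto simp del: level.simps)
  also have "\<dots> \<longleftrightarrow> (\<exists>w\<in>carcs (F n). (u, v) = (vword n (ctail (F n) w), edge_word w) \<or>
      (u, v) = (edge_word w, vword n (chead (F n) w)))"
    unfolding level_triples half_edges_def by (auto simp del: full_expansion.simps)
  finally show ?thesis .
qed

text \<open>The pair of empty words is the loop of level 0. All later levels are bipartite, with
  edge words on one side and vertex words on the other.\<close>

lemma horizontal_iff: "(u, v) \<in> horizontal \<longleftrightarrow> u = [] \<and> v = [] \<or>
    (\<exists>n w z. w \<in> carcs (F n) \<and> z \<in> ends n w \<and>
      (u = edge_word w \<and> v = vword n z \<or> v = edge_word w \<and> u = vword n z))"
proof -
  have "(u, v) \<in> horizontal \<longleftrightarrow> (\<exists>n. (\<exists>a\<in>carcs (level V n). (u, v) = (ctail (level V n) a, chead (level V n) a)) \<or>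
      (\<exists>a\<in>carcs (level V n). (v, u) = (ctail (level V n) a, chead (level V n) a)))" (is "_ \<longleftrightarrow> (\<exists>n. ?P n)")
    unfolding horizontal_def by blast
  also have "\<dots> \<longleftrightarrow> ?P 0 \<or> (\<exists>n. ?P (Suc n))" by (rule ex_nat_Suc)
  also have "?P 0 \<longleftrightarrow> u = [] \<and> v = []" by (auto simp: base_level_def)
  also have "(\<exists>n. ?P (Suc n)) \<longleftrightarrow> (\<exists>n w z. w \<in> carcs (F n) \<and> z \<in> ends n w \<and>
      (u = edge_word w \<and> v = vword n z \<or> v = edge_word w \<and> u = vword n z))"
    unfolding level_ends ends_def by blast
  finally show ?thesis .
qed

lemma horizontal_sym: "sym horizontal"
  unfolding sym_def horizontal_iff by blast

lemma near_eq_sym: "(u, v) \<in> near_eq \<Longrightarrow> (v, u) \<in> near_eq"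
  using horizontal_sym by (auto simp: sym_def)

lemma edge_vertex_near: "w \<in> carcs (F n) \<Longrightarrow> z \<in> ends n w \<Longrightarrow> (edge_word w, vword n z) \<in> near_eq"
  using horizontal_iff by blast

lemma ends_verts: "w \<in> carcs (F n) \<Longrightarrow> z \<in> ends n w \<Longrightarrow> z \<in> cverts (F n)"
  using F_ends unfolding ends_def by blast

text \<open>An edge word is no vertex word and determines its edge and, by its length, its
  level.\<close>

lemma near_edge_word:
  assumes w: "w \<in> carcs (F n)" and near: "(edge_word w, u) \<in> near_eq"
  shows "u = edge_word w \<or> (\<exists>z\<in>ends n w. u = vword n z)"
proof (cases "u = edge_word w")
  case False
  have "w \<noteq> []" using F_arc[OF w] by auto
  then have "(edge_word w :: ('c, 'v, 'e) letter list) \<noteq> []" by (metis edge_word_inject edge_word_simps(1))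
  with near False obtain m w' z where w': "w' \<in> carcs (F m)" "z \<in> ends m w'"
    "edge_word w = (edge_word w' :: ('c, 'v, 'e) letter list)" "u = vword m z"
    using edge_word_neq_vertex_word unfolding horizontal_iff Un_iff by blast
  then have "w = w'" by simp
  moreover have "m = n" using F_arc[OF w] F_arc[OF w'(1)] \<open>w = w'\<close> by simp
  ultimately show ?thesis using w' by blast
qed simp

lemma horizontal_length: "(u, v) \<in> horizontal \<Longrightarrow> length u = length v"
  unfolding horizontal_iff using F_arc length_vword ends_verts by fastforce

text \<open>Where the vertices of a copy of \<open>X c\<close>, the replacement of the edge \<open>w\<close>, come from.\<close>

definition parent_word where
  "parent_word n w v = (if v = iota_v S (col (F n) w) then vword n (ctail (F n) w)
     else if v = tau_v S (col (F n) w) then vword n (chead (F n) w) else edge_word w)"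

lemma butlast_vword_glue: "w \<in> carcs (F n) \<Longrightarrow> butlast (vword (Suc n) (glue S (F n) w v)) = parent_word n w v"
  unfolding vword_glue parent_word_def by simp

lemma near_parent_word: "w \<in> carcs (F n) \<Longrightarrow> (edge_word w, parent_word n w v) \<in> near_eq"
  unfolding parent_word_def using edge_vertex_near[of w n] unfolding ends_def by auto

text \<open>No edge of \<open>X c\<close> joins the two distinguished vertices, so an edge of the copy does not
  connect the two ends of \<open>w\<close>.\<close>

lemma parent_words_near:
  assumes "w \<in> carcs (F n)" and e: "e \<in> carcs (X (Some (col (F n) w)))"
    and x: "x \<in> {ctail (X (Some (col (F n) w))) e, chead (X (Some (col (F n) w))) e}"
    and y: "y \<in> {ctail (X (Some (col (F n) w))) e, chead (X (Some (col (F n) w))) e}"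
  shows "(parent_word n w x, parent_word n w y) \<in> near_eq"
proof -
  let ?i = "iota_v S (col (F n) w)" and ?t = "tau_v S (col (F n) w)"
  have "col (F n) w \<in> colors S" using F_arc assms(1) by blast
  from iota_tau(4)[OF this e] have "x = y \<or> {x, y} \<noteq> {?i, ?t}" using x y by auto
  then have "x = y \<or> x \<notin> {?i, ?t} \<or> y \<notin> {?i, ?t}" by auto
  moreover have "parent_word n w v = edge_word w" if "v \<notin> {?i, ?t}" for v
    using that by (simp add: parent_word_def)
  ultimately consider "x = y" | "parent_word n w x = edge_word w" | "parent_word n w y = edge_word w" by blast
  then show ?thesis
    using near_parent_word[OF assms(1), of x] near_parent_word[OF assms(1), of y] near_eq_sym
    by cases auto
qed

lemma butlast_near_edge_word:
  assumes "w \<in> carcs (F (Suc n))" "w = u @ [(Some (col (F n) u), e)]" "u \<in> carcs (F n)"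
    and "(edge_word w, a) \<in> near_eq"
  shows "butlast a = edge_word u \<or> (\<exists>x\<in>{ctail (X (Some (col (F n) u))) e, chead (X (Some (col (F n) u))) e}.
    butlast a = parent_word n u x)"
  using near_edge_word[OF assms(1,4)]
proof (elim disjE bexE)
  fix z assume "z \<in> ends (Suc n) w" "a = vword (Suc n) z"
  then show ?thesis unfolding ends_def assms(2) ends_FSuc using butlast_vword_glue[OF assms(3)] by auto
qed (use assms(2) butlast_edge_word in auto)

text \<open>The neighbours of the word of an edge are the ends of its last letter \<open>e\<close>
  in the copy that replaced \<open>u\<close>. Their parents are the edge word of \<open>u\<close> or
  words of ends of \<open>u\<close>, and \<open>e\<close> never touches both distinguished vertices,
  so any two of the occurring parents are equal or neighbours.\<close>

lemma parents_via_edge: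
  assumes w: "w \<in> carcs (F n)" and a: "(edge_word w, a) \<in> near_eq" and b: "(edge_word w, b) \<in> near_eq"
  shows "(butlast a, butlast b) \<in> near_eq"
proof (cases n)
  case 0
  have "length a = length w" "length b = length w" using a b horizontal_length by fastforce+
  then have "length a = Suc 0" "length b = Suc 0" using F_arc[OF w] 0 by simp_all
  then have "butlast a = []" "butlast b = []" by (auto simp: length_Suc_conv)
  then show ?thesis by simp
next
  case (Suc m)
  then obtain u e where u: "w = u @ [(Some (col (F m) u), e)]" "u \<in> carcs (F m)"
    "e \<in> carcs (X (Some (col (F m) u)))" using w unfolding arcs_FSuc Suc by blast
  note bl = butlast_near_edge_word[OF w[unfolded Suc] u(1,2)]
  from bl[OF a] show ?thesis
  proof (elim disjE bexE)
    assume a': "butlast a = edge_word u"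
    from bl[OF b] show ?thesis
    proof (elim disjE bexE)
      assume "butlast b = edge_word u"
      with a' show ?thesis by simp
    next
      fix y assume "butlast b = parent_word m u y"
      with a' near_parent_word[OF u(2), of y] show ?thesis by (simp only:)
    qed
  next
    fix x assume x: "x \<in> {ctail (X (Some (col (F m) u))) e, chead (X (Some (col (F m) u))) e}"
      and a': "butlast a = parent_word m u x"
    from bl[OF b] show ?thesis
    proof (elim disjE bexE)
      assume "butlast b = edge_word u"
      with a' near_eq_sym[OF near_parent_word[OF u(2), of x]] show ?thesis by (simp only:)
    next
      fix y assume "y \<in> {ctail (X (Some (col (F m) u))) e, chead (X (Some (col (F m) u))) e}"
        and "butlast b = parent_word m u y"
      with a' parent_words_near[OF u(2,3) x] show ?thesis by (simp only:)
    qed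
  qed
qed

lemma horizontal_parent: "(u, v) \<in> horizontal \<Longrightarrow> (butlast u, butlast v) \<in> near_eq"
proof -
  assume uv: "(u, v) \<in> horizontal"
  then consider "u = []" "v = []" | n w where "w \<in> carcs (F n)" "u = edge_word w \<or> v = edge_word w"
    unfolding horizontal_iff by blast
  then show ?thesis
  proof cases
    case 2
    then have "(edge_word w, u) \<in> near_eq" "(edge_word w, v) \<in> near_eq" using uv near_eq_sym by blast+
    with parents_via_edge[OF 2(1)] show ?thesis by blast
  qed simp
qed

text \<open>If the middle step is not trivial, one of its two ends is an edge word. The two steps
  through this word become at most one by \<open>parents_via_edge\<close>, and the third step stays
  at most one.\<close>

lemma horizontal_contraction:
  assumes "(u, v) \<in> near_eq ^^ 3"
  shows "(butlast u, butlast v) \<in> near_eq ^^ 2"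
proof -
  from assms obtain a b where path: "(u, a) \<in> near_eq" "(a, b) \<in> near_eq" "(b, v) \<in> near_eq"
    by (auto simp only: numeral_3_eq_3 relpow.simps relcomp.simps)
  have parent: "(butlast x, butlast y) \<in> near_eq" if "(x, y) \<in> near_eq" for x y
    using that horizontal_parent by auto
  have "\<exists>c. (butlast u, c) \<in> near_eq \<and> (c, butlast v) \<in> near_eq"
  proof -
    from path(2) consider "a = b" | n w where "w \<in> carcs (F n)" "a = edge_word w"
      | n w where "w \<in> carcs (F n)" "b = edge_word w"
      unfolding Un_iff horizontal_iff by blast
    then show ?thesis
    proof cases
      case 1
      then show ?thesis using parent path by blast
    next
      case 2
      with path have "(butlast u, butlast b) \<in> near_eq" using parents_via_edge near_eq_sym by blast
      with parent[OF path(3)] show ?thesis by blast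
    next
      case 3
      with path have "(butlast a, butlast v) \<in> near_eq" using parents_via_edge near_eq_sym by blast
      with parent[OF path(1)] show ?thesis by blast
    qed
  qed
  then show ?thesis by (auto simp only: numeral_2_eq_2 relpow.simps relcomp.simps Id_O_R)
qed

subsection \<open>Vertices of the history graph\<close>

lemma type_graph_wf: "wf_digraph \<Sigma>"
proof
  fix x assume "x \<in> arcs \<Sigma>"
  then show "tail \<Sigma> x \<in> verts \<Sigma>" "head \<Sigma> x \<in> verts \<Sigma>"
    using graph_facts(4) by (auto simp: ers_type_graph_def node_of_def indices_def)
qed

definition path_to where "path_to u q \<longleftrightarrow> pre_digraph.awalk \<Sigma> Source u q"

lemma path_to_Nil: "path_to [] q \<longleftrightarrow> q = Source"
  unfolding path_to_def pre_digraph.awalk_def by (auto simp: ers_type_graph_def pre_digraph.cas.simps)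

lemma path_to_snoc: "path_to (u @ [x]) q \<longleftrightarrow> (\<exists>q'. path_to u q' \<and> x \<in> arcs \<Sigma> \<and> tail \<Sigma> x = q' \<and> head \<Sigma> x = q)"
proof -
  interpret wf_digraph \<Sigma> by (rule type_graph_wf)
  show ?thesis unfolding path_to_def
    by (auto simp: awalk_Cons_iff awalk_Nil_iff awalk_ends_eqD)
qed

lemma verts_H: "verts H = {u. \<exists>q. path_to u q}"
  by (simp add: history_graph_def start_paths_def vers_of_def path_to_def)

lemma type_graph_arcs_from:
  "x \<in> arcs \<Sigma> \<and> tail \<Sigma> x = Source \<and> head \<Sigma> x = q \<longleftrightarrow>
    (\<exists>e\<in>carcs (X None). x = EdgeL None e \<and> q = Col (col (X None) e)) \<or>
    (\<exists>v\<in>cverts (X None). x = VertL None v \<and> q = Star)"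
  "c \<in> colors S \<Longrightarrow> x \<in> arcs \<Sigma> \<and> tail \<Sigma> x = Col c \<and> head \<Sigma> x = q \<longleftrightarrow>
    (\<exists>e\<in>carcs (X (Some c)). x = EdgeL (Some c) e \<and> q = Col (col (X (Some c)) e)) \<or>
    (\<exists>v\<in>inner_verts S c. x = VertL (Some c) v \<and> q = Star)"
  "x \<in> arcs \<Sigma> \<and> tail \<Sigma> x = Star \<and> head \<Sigma> x = q \<longleftrightarrow> x = LoopV \<and> q = Star"
  by (auto simp: ers_type_graph_def node_of_def indices_def split: option.splits)

text \<open>The type is part of the induction because it decides which letters may follow: an edge
  word has the color of its edge as type, while vertex words end in \<open>Star\<close>, where only
  \<open>LoopV\<close> continues.\<close>

lemma path_to_length_Suc:
  "length u = Suc n \<and> path_to u q \<longleftrightarrow>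
    (\<exists>w\<in>carcs (F n). u = edge_word w \<and> q = Col (col (F n) w)) \<or> (\<exists>z\<in>cverts (F n). u = vword n z \<and> q = Star)"
proof (induction n arbitrary: u q)
  case 0
  have "length u = Suc 0 \<and> path_to u q \<longleftrightarrow>
      (\<exists>x. u = [x] \<and> (x \<in> arcs \<Sigma> \<and> tail \<Sigma> x = Source \<and> head \<Sigma> x = q))"
    using path_to_snoc[of "[]"] path_to_Nil by (auto simp: length_Suc_conv)
  also have "\<dots> \<longleftrightarrow> (\<exists>e\<in>carcs (X None). u = [EdgeL None e] \<and> q = Col (col (X None) e)) \<or>
      (\<exists>v\<in>cverts (X None). u = [VertL None v] \<and> q = Star)"
    unfolding type_graph_arcs_from(1) by blast
  also have "\<dots> \<longleftrightarrow> (\<exists>w\<in>carcs (F 0). u = edge_word w \<and> q = Col (col (F 0) w)) \<or>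
      (\<exists>z\<in>cverts (F 0). u = vword 0 z \<and> q = Star)"
    unfolding arcs_F0 verts_F0 Setcompr_eq_image bex_simps(7) Collect_mem_eq
    by (simp add: col_F0 vertex_word_def last_index_def del: full_expansion.simps)
  finally show ?case .
next
  case (Suc n)
  have "length u = Suc (Suc n) \<and> path_to u q \<longleftrightarrow>
      (\<exists>u' x q'. u = u' @ [x] \<and> (length u' = Suc n \<and> path_to u' q') \<and> (x \<in> arcs \<Sigma> \<and> tail \<Sigma> x = q' \<and> head \<Sigma> x = q))"
  proof (cases u rule: rev_cases)
    case (snoc u' x)
    then show ?thesis using path_to_snoc[of u' x q] by auto
  qed simp
  also have "\<dots> \<longleftrightarrow> (\<exists>u' x q'. u = u' @ [x] \<and>
      ((\<exists>w\<in>carcs (F n). u' = edge_word w \<and> q' = Col (col (F n) w)) \<or> (\<exists>z\<in>cverts (F n). u' = vword n z \<and> q' = Star)) \<and>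
      (x \<in> arcs \<Sigma> \<and> tail \<Sigma> x = q' \<and> head \<Sigma> x = q))"
    unfolding Suc.IH ..
  also have "\<dots> \<longleftrightarrow>
      (\<exists>w\<in>carcs (F n). \<exists>x. u = edge_word w @ [x] \<and> (x \<in> arcs \<Sigma> \<and> tail \<Sigma> x = Col (col (F n) w) \<and> head \<Sigma> x = q)) \<or>
      (\<exists>z\<in>cverts (F n). \<exists>x. u = vword n z @ [x] \<and> (x \<in> arcs \<Sigma> \<and> tail \<Sigma> x = Star \<and> head \<Sigma> x = q))"
    by blast
  also have "\<dots> \<longleftrightarrow>
      (\<exists>w\<in>carcs (F n). (\<exists>e\<in>carcs (X (Some (col (F n) w))). u = edge_word w @ [EdgeL (Some (col (F n) w)) e] \<and>
          q = Col (col (X (Some (col (F n) w))) e)) \<or>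
        (\<exists>v\<in>inner_verts S (col (F n) w). u = edge_word w @ [VertL (Some (col (F n) w)) v] \<and> q = Star)) \<or>
      (\<exists>z\<in>cverts (F n). u = vword n z @ [LoopV] \<and> q = Star)"
  proof -
    have eq1: "(\<exists>x. u = edge_word w @ [x] \<and> (x \<in> arcs \<Sigma> \<and> tail \<Sigma> x = Col (col (F n) w) \<and> head \<Sigma> x = q)) \<longleftrightarrow>
        (\<exists>e\<in>carcs (X (Some (col (F n) w))). u = edge_word w @ [EdgeL (Some (col (F n) w)) e] \<and>
          q = Col (col (X (Some (col (F n) w))) e)) \<or>
        (\<exists>v\<in>inner_verts S (col (F n) w). u = edge_word w @ [VertL (Some (col (F n) w)) v] \<and> q = Star)"
      if "w \<in> carcs (F n)" for w
    proof -
      have "col (F n) w \<in> colors S" using F_arc[OF that] by blast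
      then show ?thesis using type_graph_arcs_from(2) by blast
    qed
    have eq2: "(\<exists>x. u = vword n z @ [x] \<and> (x \<in> arcs \<Sigma> \<and> tail \<Sigma> x = Star \<and> head \<Sigma> x = q)) \<longleftrightarrow>
        u = vword n z @ [LoopV] \<and> q = Star" for z
      unfolding type_graph_arcs_from(3) by blast
    show ?thesis
      by (rule arg_cong2[where f = "(\<or>)"]; rule bex_cong; (rule refl | erule eq1 | rule eq2))
  qed
  also have "\<dots> \<longleftrightarrow> (\<exists>w\<in>carcs (F (Suc n)). u = edge_word w \<and> q = Col (col (F (Suc n)) w)) \<or>
      (\<exists>z\<in>cverts (F (Suc n)). u = vword (Suc n) z \<and> q = Star)" (is "?L \<longleftrightarrow> ?R1 \<or> ?R2")
  proof -
    have "?R1 \<longleftrightarrow> (\<exists>w\<in>carcs (F n). \<exists>e\<in>carcs (X (Some (col (F n) w))).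
        u = edge_word w @ [EdgeL (Some (col (F n) w)) e] \<and> q = Col (col (X (Some (col (F n) w))) e))"
      unfolding arcs_FSuc by (fastforce simp: col_FSuc simp del: full_expansion.simps)
    moreover have "?R2 \<longleftrightarrow> (\<exists>w\<in>carcs (F n). \<exists>v\<in>inner_verts S (col (F n) w).
        u = edge_word w @ [VertL (Some (col (F n) w)) v] \<and> q = Star) \<or>
        (\<exists>z\<in>cverts (F n). u = vword n z @ [LoopV] \<and> q = Star)"
    proof -
      have "(\<exists>z\<in>cverts (F n). u = vword (Suc n) z \<and> q = Star) \<longleftrightarrow>
          (\<exists>z\<in>cverts (F n). u = vword n z @ [LoopV] \<and> q = Star)"
        by (rule bex_cong[OF refl]) (simp only: vword_Suc_old)
      moreover have "(\<exists>w\<in>carcs (F n). \<exists>v\<in>inner_verts S (col (F n) w). u = vword (Suc n) (w, v) \<and> q = Star) \<longleftrightarrow>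
          (\<exists>w\<in>carcs (F n). \<exists>v\<in>inner_verts S (col (F n) w).
            u = edge_word w @ [VertL (Some (col (F n) w)) v] \<and> q = Star)"
        by (rule bex_cong[OF refl]) (simp only: vword_Suc_new)
      ultimately show ?thesis unfolding verts_FSuc bex_Un by blast
    qed
    ultimately show ?thesis by blast
  qed
  finally show ?case .
qed

lemma verts_H_cases:
  assumes "u \<in> verts H"
  obtains "u = []" | n w where "w \<in> carcs (F n)" "u = edge_word w" | n z where "z \<in> cverts (F n)" "u = vword n z"
proof (cases "length u")
  case (Suc n)
  with assms path_to_length_Suc[of u n] show thesis using that unfolding verts_H by blast
qed (use that in simp)

lemma edge_word_verts: "w \<in> carcs (F n) \<Longrightarrow> edge_word w \<in> verts H"
  and vword_verts: "z \<in> cverts (F n) \<Longrightarrow> vword n z \<in> verts H"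
  using path_to_length_Suc unfolding verts_H by blast+

lemma neighbours_H: "(u, v) \<in> neighbours H \<longleftrightarrow> (u, v) \<in> horizontal \<or>
    u \<in> verts H \<and> v \<in> verts H \<and> (\<exists>x. v = u @ [x] \<or> u = v @ [x])"
proof -
  have ends: "(u, v) \<in> arcs_ends H \<longleftrightarrow>
      (u \<in> verts H \<and> v \<in> verts H \<and> (\<exists>x. v = u @ [x])) \<or>
      (\<exists>n. \<exists>a\<in>carcs (level V n). (u, v) = (ctail (level V n) a, chead (level V n) a))" for u v
  proof
    assume "(u, v) \<in> arcs_ends H"
    then obtain a where a: "a \<in> arcs H" "u = tail H a" "v = head H a" unfolding arcs_ends_conv by auto
    then show "(u \<in> verts H \<and> v \<in> verts H \<and> (\<exists>x. v = u @ [x])) \<or>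
        (\<exists>n. \<exists>a\<in>carcs (level V n). (u, v) = (ctail (level V n) a, chead (level V n) a))"
      by (cases a) (auto simp: history_graph_def)
  next
    assume "(u \<in> verts H \<and> v \<in> verts H \<and> (\<exists>x. v = u @ [x])) \<or>
        (\<exists>n. \<exists>a\<in>carcs (level V n). (u, v) = (ctail (level V n) a, chead (level V n) a))"
    then consider x where "u \<in> verts H" "v \<in> verts H" "v = u @ [x]"
      | n a where "a \<in> carcs (level V n)" "u = ctail (level V n) a" "v = chead (level V n) a" by blast
    then have "\<exists>a. a \<in> arcs H \<and> u = tail H a \<and> v = head H a"
    proof cases
      case 1
      then show ?thesis by (intro exI[of _ "Vertical u x"]) (auto simp: history_graph_def)
    next
      case 2
      then show ?thesis by (intro exI[of _ "Horizontal n a"]) (auto simp: history_graph_def)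
    qed
    then show "(u, v) \<in> arcs_ends H" unfolding arcs_ends_conv by auto
  qed
  show ?thesis unfolding neighbours_def Un_iff converse_iff ends horizontal_def by blast
qed

text \<open>The empty word is included to make the set closed under prefixes; it codes the
  root.\<close>

definition edge_words where "edge_words = {w. w = [] \<or> (\<exists>n. w \<in> carcs (F n))}"

sublocale coded_augmented_tree H horizontal edge_words "\<lambda>(i, e). EdgeL i e"
proof
  show "[] \<in> verts H" unfolding verts_H using path_to_Nil by blast
  show "u \<in> verts H" if "u @ [x] \<in> verts H" for u x using that path_to_snoc unfolding verts_H by blast
  show "u \<in> verts H" if "(u, v) \<in> horizontal" for u v
    using that \<open>[] \<in> verts H\<close> edge_word_verts vword_verts ends_verts unfolding horizontal_iff by blast
  show "length u = length v" if "(u, v) \<in> horizontal" for u v using that by (rule horizontal_length)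
  show "sym horizontal" by (rule horizontal_sym)
  show "(u, v) \<in> neighbours H \<longleftrightarrow> (u, v) \<in> horizontal \<or>
    u \<in> verts H \<and> v \<in> verts H \<and> (\<exists>x. v = u @ [x] \<or> u = v @ [x])" for u v by (rule neighbours_H)
  show "(butlast u, butlast v) \<in> near_eq" if "(u, v) \<in> horizontal" for u v using that by (rule horizontal_parent)
  show "(butlast u, butlast v) \<in> near_eq ^^ 2" if "(u, v) \<in> near_eq ^^ 3" for u v
    using that by (rule horizontal_contraction)
  show "u \<in> edge_words" if "u @ [a] \<in> edge_words" for u a
  proof -
    from that obtain n where n: "u @ [a] \<in> carcs (F n)" unfolding edge_words_def by blast
    show ?thesis
    proof (cases n)
      case 0
      with n show ?thesis unfolding edge_words_def 0 arcs_F0 by auto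
    next
      case (Suc m)
      with n show ?thesis unfolding edge_words_def Suc arcs_FSuc by auto
    qed
  qed
  show "map (\<lambda>(i, e). EdgeL i e) w \<in> verts H" if "w \<in> edge_words" for w
    using that \<open>[] \<in> verts H\<close> edge_word_verts unfolding edge_words_def edge_word_def by auto
  show "finite {w \<in> edge_words. length w = n}" for n
  proof (rule finite_subset)
    \<comment> \<open>Edges of length \<open>n\<close> are arcs of \<open>F (n - 1)\<close>; for
      \<open>n = 0\<close> the truncated index merely enlarges the finite set.\<close>
    show "{w \<in> edge_words. length w = n} \<subseteq> insert [] (carcs (F (n - 1)))"
      using F_arc unfolding edge_words_def by fastforce
  qed (simp add: F_finite)
  show "\<exists>w\<in>edge_words. (u, map (\<lambda>(i, e). EdgeL i e) w) \<in> near_eq" if "u \<in> verts H" for u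
    using that
  proof (cases rule: verts_H_cases)
    case 1
    then show ?thesis unfolding edge_words_def by (intro bexI[of _ "[]"]) auto
  next
    case (2 n w)
    then show ?thesis unfolding edge_words_def edge_word_def by auto
  next
    case (3 n z)
    \<comment> \<open>The coded word next to a vertex word is that of an incident edge, which exists
      since there are no isolated vertices.\<close>
    then obtain w where w: "w \<in> carcs (F n)" "z \<in> ends n w" using F_not_isolated unfolding ends_def by blast
    from near_eq_sym[OF edge_vertex_near[OF this]] w(1) 3(2) show ?thesis
      unfolding edge_words_def edge_word_def by blast
  qed
qed

section \<open>Identification with the limit space of the edge replacement system\<close>

lemma symbol_space_eq: "symbol_space S = infinite_words edge_words"
proof -
  have "prefix_of (Suc n) x \<in> edge_words \<longleftrightarrow> prefix_of (Suc n) x \<in> carcs (F n)" for n x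
  proof
    assume "prefix_of (Suc n) x \<in> edge_words"
    then obtain m where m: "prefix_of (Suc n) x \<in> carcs (F m)" unfolding edge_words_def by auto
    with F_arc[OF m] show "prefix_of (Suc n) x \<in> carcs (F n)" by simp
  qed (auto simp: edge_words_def)
  then have "x \<in> symbol_space S \<longleftrightarrow> (\<forall>n. prefix_of (Suc n) x \<in> edge_words)" for x
    unfolding symbol_space_def by blast
  moreover have "prefix_of 0 x \<in> edge_words" for x unfolding edge_words_def by simp
  ultimately have "x \<in> symbol_space S \<longleftrightarrow> (\<forall>n. prefix_of n x \<in> edge_words)" for x
    using all_nat_Suc[of "\<lambda>n. prefix_of n x \<in> edge_words"] by (simp only: simp_thms)
  then show ?thesis unfolding infinite_words_def by blast
qed

text \<open>Two horizontal steps between distinct edge words pass through a vertex word, and since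
  \<open>vword\<close> is injective it belongs to a common end.\<close>

lemma adjacent_edges_iff:
  assumes "w \<in> carcs (F n)" "w' \<in> carcs (F n)"
  shows "(edge_word w, edge_word w') \<in> near_eq ^^ 2 \<longleftrightarrow> w = w' \<or> adjacent_edges (dig (F n)) w w'"
proof
  assume "(edge_word w, edge_word w') \<in> near_eq ^^ 2"
  then obtain a where a: "(edge_word w, a) \<in> near_eq" "(a, edge_word w') \<in> near_eq"
    by (auto simp only: numeral_2_eq_2 relpow.simps relcomp.simps Id_O_R)
  note c = near_edge_word[OF assms(1) a(1)] near_edge_word[OF assms(2) near_eq_sym[OF a(2)]]
  show "w = w' \<or> adjacent_edges (dig (F n)) w w'"
  proof (cases "w = w'")
    case False
    have "a \<noteq> edge_word w" using c(2) False by (auto simp: edge_word_neq_vertex_word)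
    moreover have "a \<noteq> edge_word w'" using c(1) False by (auto simp: edge_word_neq_vertex_word)
    ultimately obtain z z' where "z \<in> ends n w" "z' \<in> ends n w'" "vword n z = vword n z'" using c by metis
    then have "ends n w \<inter> ends n w' \<noteq> {}" unfolding vertex_word_inject by blast
    with assms False show ?thesis unfolding adjacent_edges_def ends_def by blast
  qed simp
next
  assume "w = w' \<or> adjacent_edges (dig (F n)) w w'"
  moreover have "(edge_word w, edge_word w) \<in> near_eq ^^ 2"
    by (auto simp only: numeral_2_eq_2 relpow.simps relcomp.simps Id_O_R)
  moreover have "(edge_word w, edge_word w') \<in> near_eq ^^ 2" if "adjacent_edges (dig (F n)) w w'"
  proof -
    from that obtain z where z: "z \<in> ends n w" "z \<in> ends n w'" unfolding adjacent_edges_def ends_def by blast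
    from edge_vertex_near[OF assms(1) z(1)] near_eq_sym[OF edge_vertex_near[OF assms(2) z(2)]]
    show ?thesis by (auto simp only: numeral_2_eq_2 relpow.simps relcomp.simps Id_O_R)
  qed
  ultimately show "(edge_word w, edge_word w') \<in> near_eq ^^ 2" by blast
qed

lemma gluing_eq: "gluing S = glued"
proof -
  have "(\<forall>n. (ray x n, ray y n) \<in> near_eq ^^ 2) \<longleftrightarrow>
      (\<forall>n. prefix_of (Suc n) x = prefix_of (Suc n) y \<or>
        adjacent_edges (dig (F n)) (prefix_of (Suc n) x) (prefix_of (Suc n) y))"
    if "x \<in> symbol_space S" "y \<in> symbol_space S" for x y
  proof -
    have arcs: "prefix_of (Suc n) x \<in> carcs (F n)" "prefix_of (Suc n) y \<in> carcs (F n)" for n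
      using that unfolding symbol_space_def by blast+
    \<comment> \<open>\<open>gluing\<close> compares prefixes of length at least 1, so the condition
      on empty prefixes in \<open>glued\<close> is split off.\<close>
    have "(ray x 0, ray y 0) \<in> near_eq ^^ 2"
      by (rule hpow_mono[of _ _ 0]) (simp_all add: ray_def)
    then have "(\<forall>n. (ray x n, ray y n) \<in> near_eq ^^ 2) \<longleftrightarrow> (\<forall>n. (ray x (Suc n), ray y (Suc n)) \<in> near_eq ^^ 2)"
      using all_nat_Suc[of "\<lambda>n. (ray x n, ray y n) \<in> near_eq ^^ 2"] by (simp only: simp_thms)
    also have "\<dots> \<longleftrightarrow> (\<forall>n. prefix_of (Suc n) x = prefix_of (Suc n) y \<or>
        adjacent_edges (dig (F n)) (prefix_of (Suc n) x) (prefix_of (Suc n) y))"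
      unfolding ray_def edge_word_def[symmetric] using adjacent_edges_iff[OF arcs] by blast
    finally show ?thesis .
  qed
  then show ?thesis unfolding gluing_def glued_def symbol_space_eq by blast
qed

lemma limit_space_eq: "limit_space S = quotient_topology (cylinder_topology (infinite_words edge_words)) glued"
  unfolding limit_space_def symbol_topology_def cylinder_topology_def gluing_eq symbol_space_eq ..

end

theorem theorem6p17:
  fixes S :: "('c,'v,'e) ers"
    and BI BT :: "'c \<Rightarrow> ('v + 'e, 'e half) pre_digraph"
  assumes "is_ers S"
    and "expanding S"
    and "admissible_partition S BI BT"
  shows "gromov_hyperbolic (history_graph (vers_of S BI BT)) \<and>
    (\<forall>p\<in>verts (history_graph (vers_of S BI BT)).
       gromov_boundary (history_graph (vers_of S BI BT)) p homeomorphic_space limit_space S)"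
proof -
  interpret expanding_ers S BI BT by standard (fact assms)+
  show ?thesis unfolding limit_space_eq using hyperbolic boundary_homeomorphic by blast
qed

end
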